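(* Let $C$ be a co-c.e.\ cohesive set. Then there is a computable copy $\mathcal{L} = (\mathbb{N}, \prec_\mathcal{L})$ of $\omega$ and a computable coloring $F \colon \mathbb{N} \rightarrow \mathbb{N}$ of $\mathcal{L}$ with the following property. Let $[\varphi]$ and $[\psi]$ be any two non-standard elements of $\Pi_C \mathcal{L}$ with $[\psi] \prec_{\Pi_C \mathcal{L}} [\varphi]$. Then for every solid color $[\delta]_{\mathrm{col}}$, there is a $[\theta]$ in $\Pi_C \mathcal{L}$ with $[\psi] \prec_{\Pi_C \mathcal{L}} [\theta] \prec_{\Pi_C \mathcal{L}} [\varphi]$ and $\widehat{F}([\theta]) = [\delta]_{\mathrm{col}}$. Also, there is a $[\theta]$ in $\Pi_C \mathcal{L}$ with $[\psi] \prec_{\Pi_C \mathcal{L}} [\theta] \prec_{\Pi_C \mathcal{L}} [\varphi]$, where $\widehat{F}([\theta])$ is a striped color.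
   Context: A set $C \subseteq \mathbb{N}$ is cohesive if it is infinite and for every c.e.\ set $W$, either $C \subseteq^* W$ or $C \subseteq^* \overline{W}$ ($X \subseteq^* Y$ means $X \setminus Y$ is finite). For a computable linear order $\mathcal{L}$ with domain $L$, the cohesive power $\Pi_C \mathcal{L}$ has as elements the classes $[\varphi]$ of partial computable $\varphi \colon \mathbb{N} \rightarrow L$ with $C \subseteq^* \mathrm{dom}(\varphi)$, modulo $\varphi =_C \psi$ iff $C \subseteq^* \{x : \varphi(x){\downarrow} = \psi(x){\downarrow}\}$; and $[\varphi] \prec_{\Pi_C \mathcal{L}} [\psi]$ iff $C \subseteq^* \{x : \varphi(x){\downarrow}, \psi(x){\downarrow}, \varphi(x) \prec_\mathcal{L} \psi(x)\}$. For $\mathcal{L}$ of type $\omega$, the standard elements of $\Pi_C \mathcal{L}$ are those represented by constant functions (the image of the canonical embedding, an initial segment of type $\omega$); the others are non-standard (equivalently, $\lim_{n \in C}\varphi(n) = \infty$). A coloring $F \colon \mathbb{N} \rightarrow \mathbb{N}$ of $\mathcal{L}$ induces a coloring $\widehat{F}$ of $\Pi_C \mathcal{L}$: colors of $\Pi_C \mathcal{L}$ are the $=_C$-equivalence classes, written $[\delta]_{\mathrm{col}}$, of partial computable functions $\delta \colon \mathbb{N} \rightarrow \mathbb{N}$ with $C \subseteq^* \mathrm{dom}(\delta)$, and $\widehat{F}([\varphi]) = [F \circ \varphi]_{\mathrm{col}}$. A color $[\delta]_{\mathrm{col}}$ is solid if there is an $x \in \mathbb{N}$ with $\delta(n) =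 x$ for almost every $n \in C$; otherwise it is striped (then $\lim_{n \in C}\delta(n) = \infty$). *)

theory Defs
  imports Main "HOL-Library.Nat_Bijection"
begin

section \<open>Partial computable functions\<close>

text \<open>
  Kleene's partial recursive functions, in the unary presentation in which tuples of
  arguments are coded by the Cantor pairing function \<^const>\<open>prod_encode\<close>.
\<close>

fun pf_primrec :: "(nat \<rightharpoonup> nat) \<Rightarrow> (nat \<rightharpoonup> nat) \<Rightarrow> nat \<Rightarrow> nat \<rightharpoonup> nat" where
  "pf_primrec f g a 0 = f a"
| "pf_primrec f g a (Suc n) =
     Option.bind (pf_primrec f g a n) (\<lambda>r. g (prod_encode (a, prod_encode (n, r))))"

text \<open>
  Unbounded search is for the least zero at which all earlier values are defined
  (and nonzero); it diverges if there is none.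
\<close>

definition pf_zero_at :: "(nat \<rightharpoonup> nat) \<Rightarrow> nat \<Rightarrow> nat \<Rightarrow> bool" where
  "pf_zero_at f a m \<longleftrightarrow>
     f (prod_encode (a, m)) = Some 0 \<and> (\<forall>k<m. \<exists>v. f (prod_encode (a, k)) = Some (Suc v))"

definition pf_mu :: "(nat \<rightharpoonup> nat) \<Rightarrow> nat \<rightharpoonup> nat" where
  "pf_mu f a = (if \<exists>m. pf_zero_at f a m then Some (LEAST m. pf_zero_at f a m) else None)"

inductive partial_computable :: "(nat \<rightharpoonup> nat) \<Rightarrow> bool" where
  pc_zero: "partial_computable (\<lambda>_. Some 0)"
| pc_Suc: "partial_computable (\<lambda>n. Some (Suc n))"
| pc_fst: "partial_computable (\<lambda>n. Some (fst (prod_decode n)))"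
| pc_snd: "partial_computable (\<lambda>n. Some (snd (prod_decode n)))"
| pc_pair: "partial_computable f \<Longrightarrow> partial_computable g \<Longrightarrow>
    partial_computable (\<lambda>n. Option.bind (f n) (\<lambda>a. Option.bind (g n) (\<lambda>b. Some (prod_encode (a, b)))))"
| pc_comp: "partial_computable f \<Longrightarrow> partial_computable g \<Longrightarrow> partial_computable (f \<circ>\<^sub>m g)"
| pc_primrec: "partial_computable f \<Longrightarrow> partial_computable g \<Longrightarrow>
    partial_computable (\<lambda>n. case prod_decode n of (a, k) \<Rightarrow> pf_primrec f g a k)"
| pc_mu: "partial_computable f \<Longrightarrow> partial_computable (pf_mu f)"

definition computable :: "(nat \<Rightarrow> nat) \<Rightarrow> bool" where
  "computable f \<longleftrightarrow> partial_computable (\<lambda>n. Some (f n))"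

definition computable_rel :: "nat rel \<Rightarrow> bool" where
  "computable_rel R \<longleftrightarrow> computable (\<lambda>p. of_bool (prod_decode p \<in> R))"

definition ce :: "nat set \<Rightarrow> bool" where
  "ce W \<longleftrightarrow> (\<exists>f. partial_computable f \<and> W = dom f)"

definition co_ce :: "nat set \<Rightarrow> bool" where
  "co_ce A \<longleftrightarrow> ce (- A)"

section \<open>Cohesive sets\<close>

definition almost_subset :: "nat set \<Rightarrow> nat set \<Rightarrow> bool" (infix "\<subseteq>\<^sup>*" 50) where
  "X \<subseteq>\<^sup>* Y \<longleftrightarrow> finite (X - Y)"

definition cohesive :: "nat set \<Rightarrow> bool" where
  "cohesive C \<longleftrightarrow> infinite C \<and> (\<forall>W. ce W \<longrightarrow> C \<subseteq>\<^sup>* W \<or> C \<subseteq>\<^sup>* - W)"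

section \<open>Computable copies of \<open>\<omega>\<close>\<close>

text \<open>The isomorphism with the usual order on \<^typ>\<open>nat\<close> is not required to be computable.\<close>

definition computable_copy_of_omega :: "nat rel \<Rightarrow> bool" where
  "computable_copy_of_omega L \<longleftrightarrow>
     computable_rel L \<and> strict_linear_order L \<and>
     (\<exists>h :: nat \<Rightarrow> nat. bij h \<and> (\<forall>m n. m < n \<longleftrightarrow> (h m, h n) \<in> L))"

section \<open>Cohesive powers of linear orders with domain \<open>\<nat>\<close>\<close>

definition coh_reps :: "nat set \<Rightarrow> (nat \<rightharpoonup> nat) set" where
  "coh_reps C = {\<phi>. partial_computable \<phi> \<and> C \<subseteq>\<^sup>* dom \<phi>}"

definition coh_eq :: "nat set \<Rightarrow> (nat \<rightharpoonup> nat) rel" where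
  "coh_eq C = {(\<phi>, \<psi>). \<phi> \<in> coh_reps C \<and> \<psi> \<in> coh_reps C \<and>
     C \<subseteq>\<^sup>* {n. \<exists>x. \<phi> n = Some x \<and> \<psi> n = Some x}}"

definition coh_class :: "nat set \<Rightarrow> (nat \<rightharpoonup> nat) \<Rightarrow> (nat \<rightharpoonup> nat) set" where
  "coh_class C \<phi> = coh_eq C `` {\<phi>}"

text \<open>
  As the domain of the order is all of \<open>\<nat>\<close>, the elements of the power do not depend on the order.
\<close>

definition coh_power :: "nat set \<Rightarrow> (nat \<rightharpoonup> nat) set set" where
  "coh_power C = coh_reps C // coh_eq C"

definition coh_less :: "nat set \<Rightarrow> nat rel \<Rightarrow> (nat \<rightharpoonup> nat) set rel" where
  "coh_less C L = {(coh_class C \<phi>, coh_class C \<psi>) | \<phi> \<psi>. \<phi> \<in> coh_reps C \<and> \<psi> \<in> coh_reps C \<and>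
     C \<subseteq>\<^sup>* {n. \<exists>x y. \<phi> n = Some x \<and> \<psi> n = Some y \<and> (x, y) \<in> L}}"

definition standard :: "nat set \<Rightarrow> (nat \<rightharpoonup> nat) set \<Rightarrow> bool" where
  "standard C \<Phi> \<longleftrightarrow> (\<exists>x. \<Phi> = coh_class C (\<lambda>_. Some x))"

definition nonstandard_elements :: "nat set \<Rightarrow> (nat \<rightharpoonup> nat) set set" where
  "nonstandard_elements C = {\<Phi> \<in> coh_power C. \<not> standard C \<Phi>}"

section \<open>Colors of cohesive powers\<close>

text \<open>
  Colors are \<open>=\<^sub>C\<close>-classes of partial computable functions into the set \<open>\<nat>\<close> of colors,
  so formally they form the same quotient as the elements of the power.
\<close>

abbreviation coh_colors :: "nat set \<Rightarrow> (nat \<rightharpoonup> nat) set set" where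
  "coh_colors C \<equiv> coh_reps C // coh_eq C"

text \<open>
  The union is over equal classes when \<open>F\<close> is computable and \<open>\<Phi>\<close> is an element of the power;
  see \<open>induced_coloring_class\<close> below.
\<close>

definition induced_coloring ::
  "nat set \<Rightarrow> (nat \<Rightarrow> nat) \<Rightarrow> (nat \<rightharpoonup> nat) set \<Rightarrow> (nat \<rightharpoonup> nat) set" where
  "induced_coloring C F \<Phi> = (\<Union>\<phi>\<in>\<Phi>. coh_class C (map_option F \<circ> \<phi>))"

definition solid_colors :: "nat set \<Rightarrow> (nat \<rightharpoonup> nat) set set" where
  "solid_colors C = {\<Delta> \<in> coh_colors C. \<exists>\<delta>\<in>\<Delta>. \<exists>x. C \<subseteq>\<^sup>* {n. \<delta> n = Some x}}"

definition striped_colors :: "nat set \<Rightarrow> (nat \<rightharpoonup> nat) set set" where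
  "striped_colors C = coh_colors C - solid_colors C"

section \<open>Independence of representatives\<close>

lemma almost_subset_Int: "C \<subseteq>\<^sup>* A \<Longrightarrow> C \<subseteq>\<^sup>* B \<Longrightarrow> A \<inter> B \<subseteq> D \<Longrightarrow> C \<subseteq>\<^sup>* D"
  unfolding almost_subset_def
  by (rule finite_subset[of _ "(C - A) \<union> (C - B)"]) auto

lemma almost_subset_mono: "C \<subseteq>\<^sup>* A \<Longrightarrow> A \<subseteq> D \<Longrightarrow> C \<subseteq>\<^sup>* D"
  using almost_subset_Int by blast

lemma equiv_coh_eq: "equiv (coh_reps C) (coh_eq C)"
proof (rule equivI)
  show "refl_on (coh_reps C) (coh_eq C)"
    unfolding refl_on_def coh_eq_def coh_reps_def by (auto elim!: almost_subset_mono)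
  show "coh_eq C \<subseteq> coh_reps C \<times> coh_reps C"
    unfolding coh_eq_def by auto
  show "sym (coh_eq C)"
    unfolding sym_def coh_eq_def by (auto elim!: almost_subset_mono)
  show "trans (coh_eq C)"
  proof (rule transI)
    fix \<phi> \<psi> \<theta> assume "(\<phi>, \<psi>) \<in> coh_eq C" "(\<psi>, \<theta>) \<in> coh_eq C"
    then have r: "\<phi> \<in> coh_reps C" "\<theta> \<in> coh_reps C"
      and 1: "C \<subseteq>\<^sup>* {n. \<exists>x. \<phi> n = Some x \<and> \<psi> n = Some x}"
      and 2: "C \<subseteq>\<^sup>* {n. \<exists>x. \<psi> n = Some x \<and> \<theta> n = Some x}"
      by (auto simp: coh_eq_def)
    have "C \<subseteq>\<^sup>* {n. \<exists>x. \<phi> n = Some x \<and> \<theta> n = Some x}"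
      by (rule almost_subset_Int[OF 1 2]) auto
    with r show "(\<phi>, \<theta>) \<in> coh_eq C"
      by (simp add: coh_eq_def)
  qed
qed

lemma coh_class_eq_iff:
  "\<phi> \<in> coh_reps C \<Longrightarrow> \<psi> \<in> coh_reps C \<Longrightarrow>
    coh_class C \<phi> = coh_class C \<psi> \<longleftrightarrow> C \<subseteq>\<^sup>* {n. \<exists>x. \<phi> n = Some x \<and> \<psi> n = Some x}"
  unfolding coh_class_def using eq_equiv_class_iff[OF equiv_coh_eq] by (auto simp: coh_eq_def)

lemma coh_less_class_iff:
  assumes "\<phi> \<in> coh_reps C" "\<psi> \<in> coh_reps C"
  shows "(coh_class C \<phi>, coh_class C \<psi>) \<in> coh_less C L \<longleftrightarrow>
    C \<subseteq>\<^sup>* {n. \<exists>x y. \<phi> n = Some x \<and> \<psi> n = Some y \<and> (x, y) \<in> L}" (is "_ \<longleftrightarrow> C \<subseteq>\<^sup>* ?A \<phi> \<psi>")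
proof
  assume "(coh_class C \<phi>, coh_class C \<psi>) \<in> coh_less C L"
  then obtain \<phi>' \<psi>' where r: "\<phi>' \<in> coh_reps C" "\<psi>' \<in> coh_reps C"
    and e: "coh_class C \<phi> = coh_class C \<phi>'" "coh_class C \<psi> = coh_class C \<psi>'"
    and l: "C \<subseteq>\<^sup>* ?A \<phi>' \<psi>'"
    unfolding coh_less_def by blast
  have 1: "C \<subseteq>\<^sup>* {n. \<exists>x. \<phi> n = Some x \<and> \<phi>' n = Some x}"
    and 2: "C \<subseteq>\<^sup>* {n. \<exists>x. \<psi> n = Some x \<and> \<psi>' n = Some x}"
    using e r assms coh_class_eq_iff by blast+
  have "C \<subseteq>\<^sup>* {n. \<exists>x. \<phi> n = Some x \<and> \<phi>' n = Some x} \<inter> {n. \<exists>x. \<psi> n = Some x \<and> \<psi>' n = Some x}"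
    using almost_subset_Int[OF 1 2] by blast
  then show "C \<subseteq>\<^sup>* ?A \<phi> \<psi>"
    by (rule almost_subset_Int[OF _ l]) auto
next
  assume "C \<subseteq>\<^sup>* ?A \<phi> \<psi>"
  then show "(coh_class C \<phi>, coh_class C \<psi>) \<in> coh_less C L"
    unfolding coh_less_def using assms by blast
qed

lemma coh_reps_map:
  assumes "computable F" "\<phi> \<in> coh_reps C"
  shows "map_option F \<circ> \<phi> \<in> coh_reps C"
proof -
  have "map_option F \<circ> \<phi> = (\<lambda>n. Some (F n)) \<circ>\<^sub>m \<phi>"
    by (auto simp: map_comp_def fun_eq_iff map_option_case split: option.split)
  moreover have "dom (map_option F \<circ> \<phi>) = dom \<phi>"
    by auto
  ultimately show ?thesis
    using assms by (auto simp: coh_reps_def computable_def intro: pc_comp)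
qed

lemma induced_coloring_class:
  assumes "computable F" "\<phi> \<in> coh_reps C"
  shows "induced_coloring C F (coh_class C \<phi>) = coh_class C (map_option F \<circ> \<phi>)"
proof -
  have "coh_class C (map_option F \<circ> \<psi>) = coh_class C (map_option F \<circ> \<phi>)"
    if "\<psi> \<in> coh_class C \<phi>" for \<psi>
  proof -
    have p: "\<psi> \<in> coh_reps C" and q: "C \<subseteq>\<^sup>* {n. \<exists>x. \<phi> n = Some x \<and> \<psi> n = Some x}"
      using that by (auto simp: coh_class_def coh_eq_def)
    then have "C \<subseteq>\<^sup>* {n. \<exists>x. (map_option F \<circ> \<psi>) n = Some x \<and> (map_option F \<circ> \<phi>) n = Some x}"
      by (auto elim!: almost_subset_mono)
    then show ?thesis
      using coh_class_eq_iff coh_reps_map assms p by blast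
  qed
  moreover have "\<phi> \<in> coh_class C \<phi>"
    using equiv_class_self[OF equiv_coh_eq assms(2)] by (simp add: coh_class_def)
  ultimately show ?thesis
    unfolding induced_coloring_def by blast
qed

end

theory Submission
  imports Defs Complex_Main "HOL-Library.Infinite_Set"
begin

text \<open>
  Put \<open>0, 1, 2, \<dots>\<close> into the order one after the other, usually at the top, but sometimes directly
  above an earlier element \<open>a\<close>, namely when \<open>a = \<phi>(n)\<close> and \<open>\<psi>(n)\<close> have been computed and an element
  of colour \<open>c\<close> is wanted in between.  Elements placed at the top start a new block, and an insertion for
  the \<open>k\<close>-th triple \<open>\<phi>, \<psi>, c\<close> at the argument \<open>n\<close> into the block number \<open>l\<close> is permitted only if
  \<open>k < l\<close> and the set \<open>C\<close> has at most \<open>2 l\<close> elements below \<open>n\<close>; the latter is a c.e. condition as \<open>C\<close>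
  is co-c.e.  As \<open>C\<close> is infinite, the blocks remain finite, and the order has type \<open>\<omega>\<close>.

  If \<open>\<phi>\<close> is non-standard, then the block number \<open>h(n)\<close> of \<open>\<phi>(n)\<close> is finite-to-one on \<open>C\<close>.  Then \<open>h\<close>
  is injective on almost all of \<open>C\<close>: the \<open>n\<close> for which no smaller \<open>m\<close> with the same value remains in
  \<open>C\<close> form a c.e. set with infinitely many elements in \<open>C\<close>.  By injectivity, \<open>C\<close> has at most
  \<open>2 h(n)\<close> elements below \<open>n\<close> for infinitely many \<open>n\<close> in \<open>C\<close>, hence for almost all, and so
  insertions are permitted almost everywhere on \<open>C\<close>.
\<close>

section \<open>Computable functions and decidable predicates\<close>

abbreviation pfst :: "nat \<Rightarrow> nat" where "pfst p \<equiv> fst (prod_decode p)"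
abbreviation psnd :: "nat \<Rightarrow> nat" where "psnd p \<equiv> snd (prod_decode p)"
abbreviation pair :: "nat \<Rightarrow> nat \<Rightarrow> nat" where "pair a b \<equiv> prod_encode (a, b)"
abbreviation decidable :: "(nat \<Rightarrow> bool) \<Rightarrow> bool" where
  "decidable P \<equiv> computable (\<lambda>x. of_bool (P x))"

lemma computable_comp:
  assumes "computable f" "computable g"
  shows "computable (\<lambda>x. f (g x))"
proof -
  have "(\<lambda>x. Some (f (g x))) = (\<lambda>x. Some (f x)) \<circ>\<^sub>m (\<lambda>x. Some (g x))"
    by (simp add: map_comp_def)
  then show ?thesis
    using assms pc_comp by (metis computable_def)
qed

lemma computable_pair: "computable f \<Longrightarrow> computable g \<Longrightarrow> computable (\<lambda>x. pair (f x) (g x))"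
  unfolding computable_def using pc_pair by fastforce

lemma computable_fst: "computable f \<Longrightarrow> computable (\<lambda>x. pfst (f x))"
  using computable_comp[of pfst f] pc_fst by (simp add: computable_def)

lemma computable_snd: "computable f \<Longrightarrow> computable (\<lambda>x. psnd (f x))"
  using computable_comp[of psnd f] pc_snd by (simp add: computable_def)

lemma computable_id: "computable (\<lambda>x. x)"
  using computable_pair[of pfst psnd] pc_fst pc_snd by (simp add: computable_def)

lemma computable_Suc: "computable f \<Longrightarrow> computable (\<lambda>x. Suc (f x))"
  using computable_comp[of Suc f] pc_Suc by (simp add: computable_def)

lemma computable_const: "computable (\<lambda>x. c)"
  by (induction c) (use pc_zero in \<open>auto simp: computable_def computable_Suc[unfolded computable_def]\<close>)

lemma pf_primrec_Some:
  "pf_primrec (\<lambda>a. Some (f a)) (\<lambda>p. Some (g p)) a n =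
    Some (rec_nat (f a) (\<lambda>n r. g (pair a (pair n r))) n)"
  by (induction n) auto

text \<open>The workhorse for concrete functions: arithmetic, bounded sums and parity are rewritten
  below as \<open>rec_nat\<close> and reduced to this lemma.\<close>

lemma computable_rec:
  assumes "computable f" "computable (\<lambda>p. g (pfst p) (pfst (psnd p)) (psnd (psnd p)))" "computable b"
  shows "computable (\<lambda>x. rec_nat (f x) (\<lambda>n r. g x n r) (b x))"
proof -
  have "computable (\<lambda>p. rec_nat (f (pfst p)) (\<lambda>n r. g (pfst p) n r) (psnd p))"
    using pc_primrec[OF assms(1,2)[unfolded computable_def]]
    by (simp add: computable_def pf_primrec_Some case_prod_unfold)
  from computable_comp[OF this computable_pair[OF computable_id assms(3)]] show ?thesis
    by simp
qed

lemmas computable_basic =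
  computable_id computable_const computable_pair computable_fst computable_snd computable_Suc

lemma computable_add:
  assumes "computable f" "computable g"
  shows "computable (\<lambda>x. f x + g x)"
proof -
  have eq: "a + b = rec_nat a (\<lambda>n r. Suc r) b" for a b :: nat
    by (induction b) auto
  show ?thesis
    unfolding eq by (intro computable_rec computable_basic assms)
qed

lemma computable_mult:
  assumes "computable f" "computable g"
  shows "computable (\<lambda>x. f x * g x)"
proof -
  have eq: "a * b = rec_nat 0 (\<lambda>n r. r + a) b" for a b :: nat
    by (induction b) auto
  show ?thesis
    unfolding eq
    by (intro computable_rec computable_basic computable_add computable_comp[OF assms(1)] assms(2))
qed

lemma computable_power:
  assumes "computable f" "computable g"
  shows "computable (\<lambda>x. f x ^ g x)"
proof -
  have eq: "a ^ b = rec_nat 1 (\<lambda>n r. r * a) b" for a b :: nat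
    by (induction b) auto
  show ?thesis
    unfolding eq
    by (intro computable_rec computable_basic computable_mult computable_comp[OF assms(1)] assms(2))
qed

lemma computable_diff:
  assumes "computable f" "computable g"
  shows "computable (\<lambda>x. f x - g x)"
proof -
  have pred: "b - 1 = rec_nat 0 (\<lambda>n r. n) b" for b :: nat
    by (induction b) auto
  have "computable (\<lambda>b. b - 1)"
    unfolding pred by (intro computable_rec computable_basic)
  note p = computable_comp[OF this]
  have "a - b = rec_nat a (\<lambda>n r. r - 1) b" for a b :: nat
    by (induction b) auto
  then have "(\<lambda>x. f x - g x) = (\<lambda>x. rec_nat (f x) (\<lambda>n r. r - 1) (g x))"
    by blast
  moreover have "computable \<dots>"
    by (intro computable_rec computable_basic p assms)
  ultimately show ?thesis
    by simp
qed

lemma computable_sum: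
  assumes "computable b" "computable (\<lambda>p. g (pfst p) (psnd p))"
  shows "computable (\<lambda>x. \<Sum>y<b x. g x y)"
proof -
  have eq: "(\<Sum>y<n. h y) = rec_nat 0 (\<lambda>n r. r + h n) n" for h :: "nat \<Rightarrow> nat" and n
    by (induction n) auto
  have "computable (\<lambda>p. g (pfst p) (pfst (psnd p)))"
    using computable_comp[OF assms(2), of "\<lambda>p. pair (pfst p) (pfst (psnd p))"]
    by (simp add: computable_basic)
  then show ?thesis
    unfolding eq by (intro computable_rec computable_basic computable_add assms)
qed

lemma decidable_not:
  assumes "decidable P"
  shows "decidable (\<lambda>x. \<not> P x)"
proof -
  have eq: "of_bool (\<not> P x) = 1 - (of_bool (P x) :: nat)" for x
    by simp
  show ?thesis
    unfolding eq by (intro computable_diff computable_const assms)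
qed

lemma decidable_and: "decidable P \<Longrightarrow> decidable Q \<Longrightarrow> decidable (\<lambda>x. P x \<and> Q x)"
  unfolding of_bool_conj by (rule computable_mult)

lemma decidable_or: "decidable P \<Longrightarrow> decidable Q \<Longrightarrow> decidable (\<lambda>x. P x \<or> Q x)"
  using decidable_not[OF decidable_and[OF decidable_not decidable_not, of P Q]] by simp

lemma decidable_less:
  assumes "computable f" "computable g"
  shows "decidable (\<lambda>x. f x < g x)"
proof -
  \<comment> \<open>Subtraction is truncated: \<open>Suc a - b\<close> vanishes exactly if
    \<open>a < b\<close>.\<close>
  have eq: "of_bool (a < b) = 1 - (Suc a - b)" for a b :: nat
    by auto
  show ?thesis
    unfolding eq by (intro computable_diff computable_basic assms)
qed

lemma decidable_le: "computable f \<Longrightarrow> computable g \<Longrightarrow> decidable (\<lambda>x. f x \<le> g x)"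
  using decidable_not[OF decidable_less, of g f] by (simp add: not_less)

lemma decidable_eq: "computable f \<Longrightarrow> computable g \<Longrightarrow> decidable (\<lambda>x. f x = g x)"
  using decidable_and[OF decidable_le decidable_le, of f g g f] by (simp add: eq_iff)

lemma computable_if:
  assumes "decidable P" "computable f" "computable g"
  shows "computable (\<lambda>x. if P x then f x else g x)"
proof -
  have eq: "(if P x then f x else g x) = of_bool (P x) * f x + of_bool (\<not> P x) * g x" for x
    by auto
  show ?thesis
    unfolding eq by (intro computable_add computable_mult decidable_not assms)
qed

lemma decidable_all_less:
  assumes "computable b" "decidable (\<lambda>p. P (pfst p) (psnd p))"
  shows "decidable (\<lambda>x. \<forall>y<b x. P x y)"
proof -
  have eq: "(\<forall>y<b x. P x y) \<longleftrightarrow> (\<Sum>y<b x. of_bool (\<not> P x y)) = (0 :: nat)" for x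
    by auto
  show ?thesis
    unfolding eq
    by (intro decidable_eq computable_sum computable_const decidable_not assms)
qed

lemma decidable_ex_less:
  assumes "computable b" "decidable (\<lambda>p. P (pfst p) (psnd p))"
  shows "decidable (\<lambda>x. \<exists>y<b x. P x y)"
  using decidable_not[OF decidable_all_less[OF assms(1), of "\<lambda>x y. \<not> P x y"]]
    decidable_not[OF assms(2)] by simp

section \<open>Parity, halving and binary codes of finite sets\<close>

lemma decidable_odd:
  assumes "computable f"
  shows "decidable (\<lambda>x. odd (f x))"
proof -
  have eq: "of_bool (odd n) = rec_nat (0 :: nat) (\<lambda>_ r. 1 - r) n" for n :: nat
    by (induction n) auto
  show ?thesis
    unfolding eq by (intro computable_rec computable_basic computable_diff assms)
qed

lemma computable_div2:
  assumes "computable f"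
  shows "computable (\<lambda>x. f x div 2)"
proof -
  have eq: "n div 2 = rec_nat 0 (\<lambda>n r. r + of_bool (odd n)) n" for n :: nat
    by (induction n) (auto elim: oddE)
  show ?thesis
    unfolding eq by (intro computable_rec computable_basic computable_add decidable_odd assms)
qed

lemma decidable_set_decode:
  assumes "computable f" "computable g"
  shows "decidable (\<lambda>x. f x \<in> set_decode (g x))"
proof -
  have eq: "d div 2 ^ n = rec_nat d (\<lambda>_ r. r div 2) n" for d n :: nat
    by (induction n) (auto simp: power_Suc2 div_mult2_eq simp del: power_Suc)
  have "computable (\<lambda>x. g x div 2 ^ f x)"
    unfolding eq by (intro computable_rec computable_basic computable_div2 assms)
  then show ?thesis
    unfolding set_decode_def by (simp add: decidable_odd)
qed

text \<open>A value of \<open>f\<close> depends on one earlier value only, so no table of values is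
  needed: follow \<open>p\<close> down until it stops descending, then compute back up the same
  chain by primitive recursion.\<close>

lemma computable_rec_chain:
  fixes p h f :: "nat \<Rightarrow> nat"
  assumes p: "computable p" and h: "computable h" and g: "computable (\<lambda>q. g (pfst q) (psnd q))"
    and f: "\<And>s. f s = (if p s < s then g s (f (p s)) else h s)"
  shows "computable f"
proof -
  define q where "q s = (if p s < s then p s else s)" for s
  define chain where "chain s j = rec_nat s (\<lambda>_ r. q r) j" for s j
  have chain_Suc: "chain s (Suc j) = q (chain s j)" for s j
    by (simp add: chain_def)
  \<comment> \<open>For \<open>j = s\<close> a further descent would start from
    \<open>chain s s = 0\<close>, which is impossible. So the chain has come to rest after
    \<open>s\<close> steps, and \<open>val\<close> may start there with \<open>h\<close>.\<close>
  have le: "p (chain s j) < chain s j \<longrightarrow> chain s j + j \<le> s" for s j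
  proof (induction j)
    case (Suc j)
    then show ?case
      by (auto simp: chain_Suc q_def split: if_splits)
  qed (simp add: chain_def)
  define val where "val s i = rec_nat (h (chain s s))
    (\<lambda>i r. if p (chain s (s - Suc i)) < chain s (s - Suc i)
      then g (chain s (s - Suc i)) r else h (chain s (s - Suc i))) i" for s i
  have "i \<le> s \<Longrightarrow> val s i = f (chain s (s - i))" for s i
  proof (induction i)
    case 0
    then show ?case
      using le[of s s] by (auto simp: val_def f[of "chain s s"])
  next
    case (Suc i)
    have "chain s (s - i) = q (chain s (s - Suc i))"
      using Suc.prems by (metis Suc_diff_Suc Suc_le_lessD chain_Suc)
    then show ?case
      using Suc by (simp add: val_def f[of "chain s (s - Suc i)"] q_def)
  qed
  from this[of s s for s] have eq: "f = (\<lambda>s. val s s)"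
    by (simp add: chain_def fun_eq_iff)
  have q: "computable q"
    unfolding q_def by (intro computable_if decidable_less computable_basic p)
  have chain: "computable (\<lambda>x. chain (u x) (v x))" if "computable u" "computable v" for u v
    unfolding chain_def
    by (intro computable_rec computable_basic that computable_comp[OF q])
  have g': "computable (\<lambda>x. g (u x) (v x))" if "computable u" "computable v" for u v
    using computable_comp[OF g computable_pair[OF that]] by simp
  show ?thesis
    unfolding eq val_def
    by (intro computable_rec computable_comp[OF h] computable_comp[OF p] computable_if
        decidable_less g' chain computable_basic computable_diff)
qed

section \<open>Semidecidable predicates\<close>

text \<open>Projections of decidable relations are used instead of domains because closure under
  connectives and quantifiers is then direct. \<open>semidecidable_ce\<close> and
  \<open>ce_semidecidable\<close> connect them with \<open>ce\<close>.\<close>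

definition semidecidable :: "(nat \<Rightarrow> bool) \<Rightarrow> bool" where
  "semidecidable P \<longleftrightarrow> (\<exists>R. decidable R \<and> (\<forall>x. P x \<longleftrightarrow> (\<exists>t. R (pair x t))))"

lemma decidable_comp: "decidable P \<Longrightarrow> computable f \<Longrightarrow> decidable (\<lambda>x. P (f x))"
  by (rule computable_comp)

lemma semidecidableI:
  "decidable (\<lambda>p. R (pfst p) (psnd p)) \<Longrightarrow> (\<And>x. P x \<longleftrightarrow> (\<exists>t. R x t)) \<Longrightarrow> semidecidable P"
  unfolding semidecidable_def by (intro exI[of _ "\<lambda>p. R (pfst p) (psnd p)"]) auto

lemma semidecidable_decidable: "decidable P \<Longrightarrow> semidecidable P"
  using decidable_comp[of P pfst] computable_fst[OF computable_id]
  by (intro semidecidableI[of "\<lambda>x _. P x"]) auto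

lemma semidecidable_comp:
  assumes "semidecidable P" "computable f"
  shows "semidecidable (\<lambda>x. P (f x))"
proof -
  obtain R where "decidable R" "\<And>x. P x \<longleftrightarrow> (\<exists>t. R (pair x t))"
    using assms(1) unfolding semidecidable_def by blast
  then show ?thesis
    by (intro semidecidableI[of "\<lambda>x t. R (pair (f x) t)"])
      (auto intro!: decidable_comp[of R] computable_basic computable_comp[OF assms(2)])
qed

lemma semidecidable_and:
  assumes "semidecidable P" "semidecidable Q"
  shows "semidecidable (\<lambda>x. P x \<and> Q x)"
proof -
  obtain R S where "decidable R" "\<And>x. P x \<longleftrightarrow> (\<exists>t. R (pair x t))"
    "decidable S" "\<And>x. Q x \<longleftrightarrow> (\<exists>t. S (pair x t))"
    using assms unfolding semidecidable_def by blast
  then show ?thesis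
    by (intro semidecidableI[of "\<lambda>x t. R (pair x (pfst t)) \<and> S (pair x (psnd t))"] decidable_and
        decidable_comp[of R "\<lambda>p. pair (pfst p) (pfst (psnd p))"]
        decidable_comp[of S "\<lambda>p. pair (pfst p) (psnd (psnd p))"] computable_basic)
      (auto, metis fst_conv prod_encode_inverse snd_conv)
qed

lemma semidecidable_or:
  assumes "semidecidable P" "semidecidable Q"
  shows "semidecidable (\<lambda>x. P x \<or> Q x)"
proof -
  obtain R S where "decidable R" "\<And>x. P x \<longleftrightarrow> (\<exists>t. R (pair x t))"
    "decidable S" "\<And>x. Q x \<longleftrightarrow> (\<exists>t. S (pair x t))"
    using assms unfolding semidecidable_def by blast
  then show ?thesis
    by (intro semidecidableI[of "\<lambda>x t. R (pair x t) \<or> S (pair x t)"] decidable_or) auto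
qed

lemma semidecidable_ex:
  assumes "semidecidable (\<lambda>p. P (pfst p) (psnd p))"
  shows "semidecidable (\<lambda>x. \<exists>y. P x y)"
proof -
  obtain R where R: "decidable R" "\<And>p. P (pfst p) (psnd p) \<longleftrightarrow> (\<exists>t. R (pair p t))"
    using assms unfolding semidecidable_def by blast
  show ?thesis
  proof (rule semidecidableI)
    show "decidable (\<lambda>p. R (pair (pair (pfst p) (pfst (psnd p))) (psnd (psnd p))))"
      by (intro decidable_comp[OF R(1)] computable_basic)
    show "(\<exists>y. P x y) \<longleftrightarrow> (\<exists>t. R (pair (pair x (pfst t)) (psnd t)))" for x
      using R(2)[of "pair x y" for y] by simp (metis fst_conv prod_encode_inverse snd_conv)
  qed
qed

text \<open>Finitely many witnesses have a common strict bound \<open>T\<close>, so a single search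
  for \<open>T\<close> outside the bounded quantifier suffices.\<close>

lemma semidecidable_all_less:
  assumes "computable b" "semidecidable (\<lambda>p. P (pfst p) (psnd p))"
  shows "semidecidable (\<lambda>x. \<forall>y<b x. P x y)"
proof -
  obtain R where R: "decidable R" "\<And>p. P (pfst p) (psnd p) \<longleftrightarrow> (\<exists>t. R (pair p t))"
    using assms unfolding semidecidable_def by blast
  show ?thesis
  proof (rule semidecidableI)
    show "decidable (\<lambda>p. \<forall>y<b (pfst p). \<exists>t<psnd p. R (pair (pair (pfst p) y) t))"
      by (intro decidable_all_less decidable_ex_less decidable_comp[OF R(1)] computable_basic
          computable_comp[OF assms(1)])
    fix x
    have R': "P x y \<longleftrightarrow> (\<exists>t. R (pair (pair x y) t))" for y
      using R(2)[of "pair x y"] by simp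
    show "(\<forall>y<b x. P x y) \<longleftrightarrow> (\<exists>T. \<forall>y<b x. \<exists>t<T. R (pair (pair x y) t))"
    proof
      assume "\<forall>y<b x. P x y"
      then obtain w where w: "\<forall>y<b x. R (pair (pair x y) (w y))"
        using R' by metis
      then have "\<forall>y<b x. \<exists>t<Suc (\<Sum>y<b x. w y). R (pair (pair x y) t)"
        by (auto intro!: exI[of _ "w _"] simp: less_Suc_eq_le member_le_sum)
      then show "\<exists>T. \<forall>y<b x. \<exists>t<T. R (pair (pair x y) t)" ..
    qed (use R' in blast)
  qed
qed

lemma partial_computable_LEAST:
  assumes "decidable (\<lambda>p. P (pfst p) (psnd p))"
  shows "partial_computable (\<lambda>x. if \<exists>y. P x y then Some (LEAST y. P x y) else None)"
proof -
  \<comment> \<open>\<open>pf_mu\<close> searches for zeros, hence the negation.\<close>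
  let ?f = "\<lambda>p. Some (of_bool (\<not> P (pfst p) (psnd p)) :: nat)"
  have zero_at: "pf_zero_at ?f x y \<longleftrightarrow> P x y \<and> (\<forall>z<y. \<not> P x z)" for x y
    by (auto simp: pf_zero_at_def)
  have "pf_mu ?f = (\<lambda>x. if \<exists>y. P x y then Some (LEAST y. P x y) else None)"
  proof
    fix x
    show "pf_mu ?f x = (if \<exists>y. P x y then Some (LEAST y. P x y) else None)"
    proof (cases "\<exists>y. P x y")
      case True
      then have "pf_zero_at ?f x (LEAST y. P x y)"
        unfolding zero_at by (auto intro: LeastI dest: not_less_Least)
      moreover from this have "(LEAST y. pf_zero_at ?f x y) = (LEAST y. P x y)"
        by (intro Least_equality) (auto simp: zero_at not_less[symmetric])
      ultimately show ?thesis
        using True unfolding pf_mu_def by auto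
    next
      case False
      then show ?thesis
        unfolding pf_mu_def zero_at by auto
    qed
  qed
  moreover have "partial_computable (pf_mu ?f)"
    using decidable_not[OF assms] unfolding computable_def by (rule pc_mu)
  ultimately show ?thesis
    by simp
qed

text \<open>Search for a pair of a value and a witness, then keep the value. Every such pair carries
  the correct value, so the least one serves.\<close>

lemma semidecidable_graph_partial_computable:
  assumes "semidecidable (\<lambda>p. f (pfst p) = Some (psnd p))"
  shows "partial_computable f"
proof -
  obtain R where R: "decidable R" "\<And>p. f (pfst p) = Some (psnd p) \<longleftrightarrow> (\<exists>t. R (pair p t))"
    using assms unfolding semidecidable_def by blast
  define P where "P x w \<longleftrightarrow> R (pair (pair x (pfst w)) (psnd w))" for x w
  have P: "P x w \<Longrightarrow> f x = Some (pfst w)" for x w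
    using R(2)[of "pair x (pfst w)"] by (auto simp: P_def)
  have ex: "\<exists>w. P x w" if y: "f x = Some y" for x y
  proof -
    obtain t where "R (pair (pair x y) t)"
      using y R(2)[of "pair x y"] by auto
    then have "P x (pair y t)"
      by (simp add: P_def)
    then show ?thesis ..
  qed
  let ?g = "\<lambda>x. if \<exists>w. P x w then Some (LEAST w. P x w) else None"
  have "f = (\<lambda>n. Some (pfst n)) \<circ>\<^sub>m ?g"
  proof
    fix x
    show "f x = ((\<lambda>n. Some (pfst n)) \<circ>\<^sub>m ?g) x"
      using P[OF LeastI_ex[of "P x"]] ex[of x] by (cases "f x") (auto simp: map_comp_def)
  qed
  moreover have "decidable (\<lambda>p. P (pfst p) (psnd p))"
    unfolding P_def by (intro decidable_comp[OF R(1)] computable_basic)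
  then have "partial_computable ((\<lambda>n. Some (pfst n)) \<circ>\<^sub>m ?g)"
    by (intro pc_comp pc_fst partial_computable_LEAST)
  ultimately show ?thesis
    by simp
qed

lemma semidecidable_ce:
  assumes "semidecidable P"
  shows "ce {x. P x}"
proof -
  let ?f = "\<lambda>x. if P x then Some (0 :: nat) else None"
  have graph: "?f x = Some y \<longleftrightarrow> P x \<and> y = 0" for x y
    by auto
  have "partial_computable ?f"
  proof (rule semidecidable_graph_partial_computable)
    show "semidecidable (\<lambda>p. ?f (pfst p) = Some (psnd p))"
      unfolding graph
      by (rule semidecidable_and[OF semidecidable_comp[OF assms]
          semidecidable_decidable[OF decidable_eq]]) (rule computable_basic)+
  qed
  moreover have "{x. P x} = dom ?f"
    by (auto split: if_splits)
  ultimately show ?thesis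
    unfolding ce_def by (intro exI[of _ ?f] conjI)
qed

section \<open>A universal partial computable function\<close>

text \<open>Syntax for the closure rules of \<open>partial_computable\<close>, so that the
  construction can range over all partial computable functions by their numbers.\<close>

datatype code =
    CZero | CSuc | CFst | CSnd | CPair code code | CComp code code | CPrim code code | CMu code

primrec sem :: "code \<Rightarrow> nat \<rightharpoonup> nat" where
  "sem CZero = (\<lambda>_. Some 0)"
| "sem CSuc = (\<lambda>n. Some (Suc n))"
| "sem CFst = (\<lambda>n. Some (pfst n))"
| "sem CSnd = (\<lambda>n. Some (psnd n))"
| "sem (CPair c d) = (\<lambda>n. Option.bind (sem c n) (\<lambda>u. Option.bind (sem d n) (\<lambda>v. Some (pair u v))))"
| "sem (CComp c d) = sem c \<circ>\<^sub>m sem d"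
| "sem (CPrim c d) = (\<lambda>n. case prod_decode n of (a, k) \<Rightarrow> pf_primrec (sem c) (sem d) a k)"
| "sem (CMu c) = pf_mu (sem c)"

primrec enc :: "code \<Rightarrow> nat" where
  "enc CZero = pair 0 0"
| "enc CSuc = pair (Suc 0) 0"
| "enc CFst = pair 2 0"
| "enc CSnd = pair 3 0"
| "enc (CPair c d) = pair 4 (pair (enc c) (enc d))"
| "enc (CComp c d) = pair 5 (pair (enc c) (enc d))"
| "enc (CPrim c d) = pair 6 (pair (enc c) (enc d))"
| "enc (CMu c) = pair 7 (enc c)"

text \<open>This makes \<open>dec\<close> terminate: a positive tag exceeds nothing in size but
  makes the content strictly smaller than the code. Tag 0 is left to \<open>CZero\<close>, which has
  no subcodes.\<close>

lemma less_prod_encode_2: "0 < a \<Longrightarrow> b < pair a b"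
proof -
  have "n \<le> triangle n" for n
    by (induction n) simp_all
  from this[of "a + b"] show "0 < a \<Longrightarrow> b < pair a b"
    by (simp add: prod_encode_def)
qed

lemma psnd_less: "pfst e \<noteq> 0 \<Longrightarrow> psnd e < e"
  using less_prod_encode_2[of "pfst e" "psnd e"] by simp

lemma pfst_le: "pfst e \<le> e" and psnd_le: "psnd e \<le> e"
  using le_prod_encode_1[of "pfst e" "psnd e"] le_prod_encode_2[of "psnd e" "pfst e"] by simp_all

text \<open>Total, with \<open>CMu\<close> as the default for all remaining tags, so that soundness
  can be stated for arbitrary numbers.\<close>

function dec :: "nat \<Rightarrow> code" where
  "dec e =
    (if pfst e = 0 then CZero else if pfst e = 1 then CSuc
     else if pfst e = 2 then CFst else if pfst e = 3 then CSnd
     else if pfst e = 4 then CPair (dec (pfst (psnd e))) (dec (psnd (psnd e)))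
     else if pfst e = 5 then CComp (dec (pfst (psnd e))) (dec (psnd (psnd e)))
     else if pfst e = 6 then CPrim (dec (pfst (psnd e))) (dec (psnd (psnd e)))
     else CMu (dec (psnd e)))"
  by auto
termination
  by (relation "measure id")
    (auto intro: psnd_less le_less_trans[OF pfst_le psnd_less] le_less_trans[OF psnd_le psnd_less])

declare dec.simps [simp del]

lemma dec_pair [simp]:
  "dec (pair 0 u) = CZero" "dec (pair (Suc 0) u) = CSuc"
  "dec (pair 2 u) = CFst" "dec (pair 3 u) = CSnd"
  "dec (pair 4 (pair c d)) = CPair (dec c) (dec d)"
  "dec (pair 5 (pair c d)) = CComp (dec c) (dec d)"
  "dec (pair 6 (pair c d)) = CPrim (dec c) (dec d)"
  "dec (pair 7 c) = CMu (dec c)"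
  by (simp_all add: dec.simps[of "pair _ _"])

lemma dec_enc: "dec (enc c) = c"
  by (induction c) simp_all

lemma partial_computable_sem: "partial_computable f \<Longrightarrow> f \<in> range sem"
proof (induction rule: partial_computable.induct)
  case pc_zero show ?case by (rule range_eqI[of _ _ CZero]) simp
next
  case pc_Suc show ?case by (rule range_eqI[of _ _ CSuc]) simp
next
  case pc_fst show ?case by (rule range_eqI[of _ _ CFst]) simp
next
  case pc_snd show ?case by (rule range_eqI[of _ _ CSnd]) simp
next
  case (pc_pair f g)
  then obtain c d where "f = sem c" "g = sem d" by blast
  then show ?case by (intro range_eqI[of _ _ "CPair c d"]) simp
next
  case (pc_comp f g)
  then obtain c d where "f = sem c" "g = sem d" by blast
  then show ?case by (intro range_eqI[of _ _ "CComp c d"]) simp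
next
  case (pc_primrec f g)
  then obtain c d where "f = sem c" "g = sem d" by blast
  then show ?case by (intro range_eqI[of _ _ "CPrim c d"]) simp
next
  case (pc_mu f)
  then obtain c where "f = sem c" by blast
  then show ?case by (intro range_eqI[of _ _ "CMu c"]) simp
qed

text \<open>
  \<open>h e x y\<close> says that the value \<open>y\<close> of the code \<open>e\<close> at \<open>x\<close> is already known.
\<close>

inductive justified :: "(nat \<Rightarrow> nat \<Rightarrow> nat \<Rightarrow> bool) \<Rightarrow> nat \<Rightarrow> nat \<Rightarrow> nat \<Rightarrow> bool" for h where
  "justified h (pair 0 0) x 0"
| "justified h (pair (Suc 0) 0) x (Suc x)"
| "justified h (pair 2 0) x (pfst x)"
| "justified h (pair 3 0) x (psnd x)"
| "h c x u \<Longrightarrow> h d x v \<Longrightarrow> justified h (pair 4 (pair c d)) x (pair u v)"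
| "h d x u \<Longrightarrow> h c u y \<Longrightarrow> justified h (pair 5 (pair c d)) x y"
| "h c a y \<Longrightarrow> justified h (pair 6 (pair c d)) (pair a 0) y"
| "h (pair 6 (pair c d)) (pair a n) u \<Longrightarrow> h d (pair a (pair n u)) y \<Longrightarrow>
    justified h (pair 6 (pair c d)) (pair a (Suc n)) y"
| "h c (pair x y) 0 \<Longrightarrow> \<forall>k<y. \<exists>v. h c (pair x k) (Suc v) \<Longrightarrow> justified h (pair 7 c) x y"

lemma justified_mono:
  assumes "justified h e x y" "\<And>e x y. h e x y \<Longrightarrow> h' e x y"
  shows "justified h' e x y"
  using assms(1) by cases (blast intro: justified.intros assms(2))+

text \<open>All values before the zero must be nonzero, so at most one \<open>y\<close> qualifies
  and \<open>LEAST\<close> merely names it.\<close>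

lemma pf_mu_eq_Some_iff: "pf_mu f x = Some y \<longleftrightarrow> pf_zero_at f x y"
proof -
  have unique: "pf_zero_at f x y \<Longrightarrow> pf_zero_at f x z \<Longrightarrow> y = z" for y z
    unfolding pf_zero_at_def by (metis linorder_neqE_nat nat.distinct(1) option.inject)
  then have "pf_zero_at f x y \<Longrightarrow> (LEAST y. pf_zero_at f x y) = y" for y
    using LeastI by metis
  then show ?thesis
    unfolding pf_mu_def by auto
qed

lemma justified_sem:
  assumes "justified (\<lambda>e x y. sem (dec e) x = Some y) e x y"
  shows "sem (dec e) x = Some y"
  using assms by cases (auto simp: pf_mu_eq_Some_iff pf_zero_at_def)

abbreviation fact :: "nat \<Rightarrow> nat \<Rightarrow> nat \<Rightarrow> nat" where
  "fact e x y \<equiv> pair e (pair x y)"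

text \<open>
  An element \<open>pair r (fact e x y)\<close> of a derivation carries a rank \<open>r\<close>; decreasing ranks keep the
  justifications well-founded.
\<close>

definition derivation :: "nat set \<Rightarrow> bool" where
  "derivation D \<longleftrightarrow> (\<forall>p\<in>D. justified (\<lambda>e x y. \<exists>r<pfst p. pair r (fact e x y) \<in> D)
    (pfst (psnd p)) (pfst (psnd (psnd p))) (psnd (psnd (psnd p))))"

definition derivable :: "nat \<Rightarrow> bool" where
  "derivable q \<longleftrightarrow> (\<exists>D r. finite D \<and> derivation D \<and> pair r q \<in> D)"

text \<open>Soundness, by induction on the rank: the premises of a justification have smaller
  rank.\<close>

lemma derivation_sem:
  assumes "derivation D" "pair r (fact e x y) \<in> D"
  shows "sem (dec e) x = Some y"
  using assms(2)
proof (induction r arbitrary: e x y rule: less_induct)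
  case (less r)
  have "justified (\<lambda>e x y. \<exists>s<r. pair s (fact e x y) \<in> D) e x y"
    using assms(1) less.prems unfolding derivation_def by fastforce
  then show ?case
    by (intro justified_sem) (auto elim!: justified_mono intro: less.IH)
qed

lemma derivation_Un:
  assumes "derivation D" "derivation D'"
  shows "derivation (D \<union> D')"
  unfolding derivation_def
proof
  fix p
  assume "p \<in> D \<union> D'"
  then obtain E where E: "derivation E" "p \<in> E" "E \<subseteq> D \<union> D'"
    using assms by blast
  show "justified (\<lambda>e x y. \<exists>r<pfst p. pair r (fact e x y) \<in> D \<union> D')
      (pfst (psnd p)) (pfst (psnd (psnd p))) (psnd (psnd (psnd p)))"
    by (rule justified_mono[OF bspec[OF E(1)[unfolded derivation_def] E(2)]]) (use E(3) in blast)
qed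

text \<open>Merged derivations keep their ranks, and \<open>m\<close> lies above those of all chosen
  premises, so it can serve as the rank of a conclusion drawn from them.\<close>

lemma derivable_common:
  assumes "finite Q" "\<forall>q\<in>Q. derivable q"
  shows "\<exists>D m. finite D \<and> derivation D \<and> (\<forall>q\<in>Q. \<exists>r<m. pair r q \<in> D)"
  using assms
proof (induction Q rule: finite_induct)
  case empty
  then show ?case
    by (intro exI[of _ "{}"]) (auto simp: derivation_def)
next
  case (insert q Q)
  then obtain D m where D: "finite D" "derivation D" "\<forall>q\<in>Q. \<exists>r<m. pair r q \<in> D"
    by auto
  obtain D' r where D': "finite D'" "derivation D'" "pair r q \<in> D'"
    using insert.prems unfolding derivable_def by auto
  have "\<exists>s<max m (Suc r). pair s q' \<in> D \<union> D'" if "q' \<in> insert q Q" for q'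
    using that D(3) D'(3) by (auto simp: less_max_iff_disj)
  then show ?case
    using D D' derivation_Un
    by (intro exI[of _ "D \<union> D'"] exI[of _ "max m (Suc r)"]) auto
qed

lemma derivable_justified:
  assumes "finite Q" "\<And>q. q \<in> Q \<Longrightarrow> derivable q"
    and just: "justified (\<lambda>e x y. fact e x y \<in> Q) e x y"
  shows "derivable (fact e x y)"
proof -
  obtain D m where D: "finite D" "derivation D" "\<forall>q\<in>Q. \<exists>r<m. pair r q \<in> D"
    using derivable_common[OF assms(1)] assms(2) by blast
  let ?p = "pair m (fact e x y)"
  have "derivation (insert ?p D)"
    unfolding derivation_def
  proof
    fix p
    assume p: "p \<in> insert ?p D"
    show "justified (\<lambda>e x y. \<exists>r<pfst p. pair r (fact e x y) \<in> insert ?p D)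
      (pfst (psnd p)) (pfst (psnd (psnd p))) (psnd (psnd (psnd p)))"
    proof (cases "p = ?p")
      case True
      then show ?thesis
        using D(3) by (auto intro!: justified_mono[OF just])
    next
      case False
      then have "p \<in> D"
        using p by simp
      then show ?thesis
        by (rule justified_mono[OF bspec[OF D(2)[unfolded derivation_def]]]) blast
    qed
  qed
  then show ?thesis
    using D(1) unfolding derivable_def by blast
qed

text \<open>Completeness, by induction on the code; primitive recursion needs an inner induction on
  its counter.\<close>

lemma derivable_sem: "sem c x = Some y \<Longrightarrow> derivable (fact (enc c) x y)"
proof (induction c arbitrary: x y)
  case CZero
  then show ?case by (intro derivable_justified[of "{}"]) (auto intro!: justified.intros)
next
  case CSuc
  then show ?case by (intro derivable_justified[of "{}"]) (auto intro!: justified.intros)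
next
  case CFst
  then show ?case by (intro derivable_justified[of "{}"]) (auto intro!: justified.intros)
next
  case CSnd
  then show ?case by (intro derivable_justified[of "{}"]) (auto intro!: justified.intros)
next
  case (CPair c d)
  then obtain u v where "sem c x = Some u" "sem d x = Some v" and [simp]: "y = pair u v"
    by (auto simp: bind_eq_Some_conv)
  then show ?case
    using CPair.IH
    by (intro derivable_justified[of "{fact (enc c) x u, fact (enc d) x v}"]) (auto intro!: justified.intros)
next
  case (CComp c d)
  then obtain u where "sem d x = Some u" "sem c u = Some y"
    by (auto simp: map_comp_def split: option.splits)
  then show ?case
    using CComp.IH
    by (intro derivable_justified[of "{fact (enc d) x u, fact (enc c) u y}"]) (auto intro!: justified.intros)
next
  case (CPrim c d)
  have "pf_primrec (sem c) (sem d) a k = Some y \<Longrightarrow> derivable (fact (enc (CPrim c d)) (pair a k) y)" for a k y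
  proof (induction k arbitrary: y)
    case 0
    then show ?case
      using CPrim.IH
      by (intro derivable_justified[of "{fact (enc c) a y}"]) (auto intro!: justified.intros)
  next
    case (Suc k)
    then obtain u where "pf_primrec (sem c) (sem d) a k = Some u"
      "sem d (pair a (pair k u)) = Some y"
      by (auto simp: bind_eq_Some_conv)
    then show ?case
      using CPrim.IH Suc.IH
      by (intro derivable_justified[of "{fact (enc (CPrim c d)) (pair a k) u, fact (enc d) (pair a (pair k u)) y}"])
        (auto intro!: justified.intros)
  qed
  then show ?case
    using CPrim.prems by (metis prod.case prod_decode_inverse sem.simps(7) surj_pair)
next
  case (CMu c)
  then have zero: "sem c (pair x y) = Some 0"
    and "\<forall>k<y. \<exists>v. sem c (pair x k) = Some (Suc v)"
    by (auto simp: pf_mu_eq_Some_iff pf_zero_at_def)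
  \<comment> \<open>Fixing the nonzero values makes the premises of the search rule a finite
    set.\<close>
  then obtain v where v: "\<And>k. k < y \<Longrightarrow> sem c (pair x k) = Some (Suc (v k))"
    by metis
  show ?case
    using CMu.IH zero v
    by (intro derivable_justified[of "insert (fact (enc c) (pair x y) 0)
        ((\<lambda>k. fact (enc c) (pair x k) (Suc (v k))) ` {..<y})"])
      (auto intro!: justified.intros)
qed

lemma derivable_enc: "derivable (fact (enc c) x y) \<longleftrightarrow> sem c x = Some y"
  using derivation_sem[of _ _ "enc c"] derivable_sem unfolding derivable_def by (metis dec_enc)

text \<open>Soundness gives this for all numbers \<open>e\<close>. It later shows that the kind and
  argument of a request determine its endpoints.\<close>

lemma derivable_unique: "derivable (fact e x y) \<Longrightarrow> derivable (fact e x z) \<Longrightarrow> y = z"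
  unfolding derivable_def by (metis derivation_sem option.inject)

lemmas semidecidable_intros =
  semidecidable_and semidecidable_or semidecidable_ex semidecidable_all_less
  semidecidable_decidable[OF decidable_eq] semidecidable_decidable[OF decidable_less]
  semidecidable_decidable[OF decidable_set_decode]
  semidecidable_decidable[OF decidable_not[OF decidable_set_decode]]

lemma set_decode_less: "p \<in> set_decode d \<Longrightarrow> p < d"
  unfolding set_decode_def
  by (metis div_less even_zero less_exp linorder_not_less mem_Collect_eq order_less_le_trans)

text \<open>Finite sets are coded by numbers \<open>d\<close> whose elements lie below
  \<open>d\<close>, so the universal quantifier over a derivation becomes bounded; unfolding
  \<open>justified\<close> leaves only existential and bounded universal quantifiers.\<close>

lemma semidecidable_derivable: "semidecidable derivable"
proof -
  have "derivable q \<longleftrightarrow> (\<exists>d r. pair r q \<in> set_decode d \<and> derivation (set_decode d))" for q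
    unfolding derivable_def by (metis finite_set_decode set_encode_inverse)
  then have eq: "derivable = (\<lambda>q. \<exists>d r. pair r q \<in> set_decode d \<and> (\<forall>p<d. p \<notin> set_decode d \<or>
      justified (\<lambda>e x y. \<exists>r<pfst p. pair r (fact e x y) \<in> set_decode d)
        (pfst (psnd p)) (pfst (psnd (psnd p))) (psnd (psnd (psnd p)))))"
    unfolding derivation_def fun_eq_iff using set_decode_less by blast
  show ?thesis
    unfolding eq justified.simps by (intro semidecidable_intros computable_basic)
qed

lemma ce_semidecidable:
  assumes "ce W"
  shows "semidecidable (\<lambda>x. x \<in> W)"
proof -
  obtain c where "W = dom (sem c)"
    using assms partial_computable_sem unfolding ce_def by blast
  then have "x \<in> W \<longleftrightarrow> (\<exists>y. derivable (fact (enc c) x y))" for x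
    by (auto simp: derivable_enc)
  then show ?thesis
    by (simp add: semidecidable_ex semidecidable_comp[OF semidecidable_derivable] computable_basic)
qed

section \<open>Copies of \<open>\<omega>\<close> built by insertion\<close>

text \<open>\<open>rank\<close> is injective, hence unbounded, and by cardinality the predecessors
  of \<open>x\<close> attain every value below \<open>rank x\<close>. So it is onto, and its inverse
  is the isomorphism.\<close>

lemma strict_linear_order_omega:
  fixes L :: "nat rel"
  assumes L: "strict_linear_order L" and fin: "\<And>x. finite {y. (y, x) \<in> L}"
  shows "\<exists>h :: nat \<Rightarrow> nat. bij h \<and> (\<forall>m n. m < n \<longleftrightarrow> (h m, h n) \<in> L)"
proof -
  have trans: "trans L" and irrefl: "\<And>x. (x, x) \<notin> L" and total: "\<And>x y. x \<noteq> y \<Longrightarrow> (x, y) \<in> L \<or> (y, x) \<in> L"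
    using L unfolding strict_linear_order_on_def irrefl_def total_on_def by auto
  define rank where "rank x = card {y. (y, x) \<in> L}" for x
  have less: "rank x < rank y" if "(x, y) \<in> L" for x y
    unfolding rank_def
  proof (rule psubset_card_mono[OF fin])
    show "{z. (z, x) \<in> L} \<subset> {z. (z, y) \<in> L}"
      using that irrefl[of x] transD[OF trans] by blast
  qed
  then have less_iff: "rank x < rank y \<longleftrightarrow> (x, y) \<in> L" for x y
    using total[of x y] by (metis less_irrefl less_asym)
  have inj: "inj rank"
    using less total by (metis injI less_irrefl)
  have down: "rank ` {y. (y, x) \<in> L} = {..<rank x}" for x
  proof (rule card_subset_eq)
    show "card (rank ` {y. (y, x) \<in> L}) = card {..<rank x}"
      using card_image[OF inj_on_subset[OF inj]] by (simp add: rank_def)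
  qed (use less in auto)
  have "surj rank"
  proof -
    have "n \<in> range rank" for n
    proof -
      have "\<not> range rank \<subseteq> {..n}"
        using inj finite_subset finite_imageD by blast
      then obtain x where "n < rank x"
        by (auto simp: image_subset_iff not_le)
      then show ?thesis
        using down[of x] by blast
    qed
    then show ?thesis
      by blast
  qed
  with inj have bij: "bij rank"
    by (simp add: bij_def)
  show ?thesis
    using bij_imp_bij_inv[OF bij] surj_f_inv_f[OF \<open>surj rank\<close>] less_iff
    by (intro exI[of _ "inv rank"]) metis
qed

text \<open>
  The numbers are placed one after the other: \<open>s\<close> becomes the immediate successor of \<open>par s\<close> among
  \<open>0, \<dots>, s\<close> if this is permitted, and the greatest element so far otherwise.  The latter elements
  cut the order into blocks, and \<open>level s\<close> is the first element of the block of \<open>s\<close>.  The position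
  \<open>pos s = num s / 2 ^ s\<close> is chosen such that the positions of \<open>0, \<dots>, s - 1\<close> are multiples of
  \<open>1 / 2 ^ (s - 1)\<close>, so that an insertion amounts to adding \<open>1 / 2 ^ s\<close>.
\<close>

locale insertion_order =
  fixes par :: "nat \<Rightarrow> nat" and permitted :: "nat \<Rightarrow> nat \<Rightarrow> bool"
  assumes computable_par: "computable par"
    and decidable_permitted: "decidable (\<lambda>p. permitted (pfst p) (psnd p))"
    and finite_permitted: "finite {s. permitted s r}"
begin

text \<open>The outer conditional puts every recursive call under the guard
  \<open>par s < s\<close>, on which termination rests.\<close>

function level :: "nat \<Rightarrow> nat" where
  "level s = (if par s < s then if permitted s (level (par s)) then level (par s) else s else s)"
  by auto
termination by (relation "measure id") auto

declare level.simps [simp del]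

definition inserted :: "nat \<Rightarrow> bool" where
  "inserted s \<longleftrightarrow> par s < s \<and> permitted s (level (par s))"

function num :: "nat \<Rightarrow> nat" where
  "num s = (if par s < s then if permitted s (level (par s)) then 2 ^ (s - par s) * num (par s) + 1
     else s * 2 ^ s else s * 2 ^ s)"
  by auto
termination by (relation "measure id") auto

declare num.simps [simp del]

definition pos :: "nat \<Rightarrow> real" where
  "pos s = num s / 2 ^ s"

definition ord :: "nat rel" where
  "ord = {(s, t). pos s < pos t}"

lemma level_eq: "level s = (if inserted s then level (par s) else s)"
  by (simp add: level.simps[of s] inserted_def)

lemma num_eq: "num s = (if inserted s then 2 ^ (s - par s) * num (par s) + 1 else s * 2 ^ s)"
  by (simp add: num.simps[of s] inserted_def)

lemma pos_inserted:
  assumes "inserted s"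
  shows "pos s = pos (par s) + 1 / 2 ^ s"
proof -
  have "(2 :: real) ^ s = 2 ^ (s - par s) * 2 ^ par s"
    using assms by (simp add: inserted_def flip: power_add)
  then show ?thesis
    using assms by (simp add: pos_def num_eq[of s] field_simps)
qed

lemma pos_not_inserted: "\<not> inserted s \<Longrightarrow> pos s = s"
  by (simp add: pos_def num_eq[of s])

text \<open>A block starts at the position equal to its first number, and insertions only move to
  the right. With \<open>finite_level_le\<close> this makes initial segments finite.\<close>

lemma level_le_pos: "level s \<le> pos s"
proof (induction s rule: less_induct)
  case (less s)
  show ?case
  proof (cases "inserted s")
    case True
    have "level (par s) \<le> pos (par s)"
      using True less by (simp add: inserted_def)
    also have "\<dots> \<le> pos (par s) + 1 / 2 ^ s"
      by simp
    finally show ?thesis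
      using True level_eq[of s] by (simp add: pos_inserted)
  qed (use level_eq[of s] in \<open>simp add: pos_not_inserted\<close>)
qed

lemma finite_level_le: "finite {s. level s \<le> r}"
proof -
  have "s = level s \<or> permitted s (level s)" for s
    using level_eq[of s] by (auto simp: inserted_def split: if_splits)
  then have "{s. level s = r} \<subseteq> insert r {s. permitted s r}" for r
    by auto
  then have "finite {s. level s = r}" for r
    by (rule finite_subset[OF _ finite.insertI[OF finite_permitted]])
  then have "finite (\<Union>q\<le>r. {s. level s = q})"
    by (intro finite_UN_I finite_atMost)
  then show ?thesis
    by (rule rev_finite_subset) auto
qed

lemma finite_pos_less: "finite {s. pos s < x}"
proof (rule finite_subset[OF _ finite_level_le])
  show "{s. pos s < x} \<subseteq> {s. level s \<le> nat \<lceil>x\<rceil>}"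
  proof
    fix s
    assume "s \<in> {s. pos s < x}"
    then have "real (level s) \<le> x"
      using level_le_pos[of s] by simp
    then show "s \<in> {s. level s \<le> nat \<lceil>x\<rceil>}"
      by (simp add: le_nat_iff) linarith
  qed
qed

lemma odd_num: "inserted s \<Longrightarrow> odd (num s)"
  by (simp add: num_eq[of s] inserted_def)

text \<open>A parity argument: if \<open>s < t\<close> share a position, then \<open>num t\<close>
  is even, so \<open>t\<close> is not inserted and has position \<open>t\<close>. An inserted
  \<open>s\<close> would then have an even numerator too, and otherwise
  \<open>s = t\<close>.\<close>

lemma inj_pos: "inj pos"
proof -
  have "pos s \<noteq> pos t" if "s < t" for s t
  proof
    assume eq: "pos s = pos t"
    have "real (num t) = num s * (2 ^ t / 2 ^ s)"
      using eq by (simp add: pos_def field_simps)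
    also have "2 ^ t / 2 ^ s = (2 :: real) ^ (t - s)"
      using that by (simp add: power_diff)
    finally have "real (num t) = real (num s * 2 ^ (t - s))"
      by simp
    then have "num t = num s * 2 ^ (t - s)"
      unfolding of_nat_eq_iff .
    then have t: "\<not> inserted t"
      using odd_num[of t] that by auto
    show False
    proof (cases "inserted s")
      case True
      then have "real (num s) = real (t * 2 ^ s)"
        using eq pos_not_inserted[OF t] by (simp add: pos_def[of s] field_simps)
      then have "num s = t * 2 ^ s"
        unfolding of_nat_eq_iff .
      then show False
        using odd_num[OF True] True by (simp add: inserted_def)
    next
      case False
      then show False
        using eq that by (simp add: pos_not_inserted t)
    qed
  qed
  then show ?thesis
    by (metis injI nat_neq_iff)
qed

text \<open>Distinct positions of numbers below \<open>s\<close> differ by at least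
  \<open>1 / 2 ^ (s - 1)\<close>, twice what is added to that of the parent.\<close>

lemma inserted_between:
  assumes s: "inserted s" and less: "pos (par s) < pos b" "b < s"
  shows "pos (par s) < pos s" "pos s < pos b"
proof -
  have a: "par s < s"
    using s by (simp add: inserted_def)
  show "pos (par s) < pos s"
    by (simp add: pos_inserted s)
  \<comment> \<open>The numerator over the common denominator \<open>2 ^ (s - 1)\<close>.\<close>
  define scaled where "scaled x = num x * 2 ^ (s - 1 - x)" for x
  have scaled: "pos x * 2 ^ (s - 1) = real (scaled x)" if "x < s" for x
  proof -
    have "(2 :: real) ^ (s - 1) = 2 ^ x * 2 ^ (s - 1 - x)"
      using that by (simp flip: power_add)
    then show ?thesis
      by (simp add: pos_def scaled_def)
  qed
  have "real (scaled (par s)) < real (scaled b)"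
    using less a by (simp flip: scaled)
  then have "real (scaled (par s) + 1) \<le> real (scaled b)"
    unfolding of_nat_le_iff by simp
  then have "pos (par s) * 2 ^ (s - 1) + 1 \<le> pos b * 2 ^ (s - 1)"
    using scaled[OF less(2)] scaled[OF a] by simp
  moreover have "(2 :: real) ^ s = 2 * 2 ^ (s - 1)"
    using a by (simp flip: power_Suc)
  ultimately show "pos s < pos b"
    by (simp add: pos_inserted s field_simps)
qed

section \<open>Computability of the order\<close>

lemma computable_level: "computable level"
proof (rule computable_rec_chain[where g = "\<lambda>s l. if permitted s l then l else s",
      OF computable_par computable_id])
  show "computable (\<lambda>q. if permitted (pfst q) (psnd q) then psnd q else pfst q)"
    by (intro computable_if decidable_permitted computable_basic)
qed (rule level.simps)

lemma decidable_inserted: "decidable inserted"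
proof -
  have "computable (\<lambda>s. pair s (level (par s)))"
    by (intro computable_basic computable_comp[OF computable_level] computable_par)
  from decidable_comp[OF decidable_permitted this]
  have "decidable (\<lambda>s. permitted s (level (par s)))"
    by simp
  then show ?thesis
    unfolding inserted_def
    by (intro decidable_and decidable_less computable_basic computable_par)
qed

lemma computable_num: "computable num"
proof (rule computable_rec_chain[where h = "\<lambda>s. s * 2 ^ s" and
      g = "\<lambda>s v. if inserted s then 2 ^ (s - par s) * v + 1 else s * 2 ^ s", OF computable_par])
  show "computable (\<lambda>s. s * 2 ^ s)"
    by (intro computable_mult computable_power computable_basic)
  show "computable (\<lambda>q. if inserted (pfst q) then 2 ^ (pfst q - par (pfst q)) * psnd q + 1
      else pfst q * 2 ^ pfst q)"
    by (intro computable_if computable_add computable_mult computable_power computable_diff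
        decidable_comp[OF decidable_inserted] computable_comp[OF computable_par] computable_basic)
  show "num s = (if par s < s
      then if inserted s then 2 ^ (s - par s) * num (par s) + 1 else s * 2 ^ s else s * 2 ^ s)" for s
    using num_eq[of s] by (simp add: inserted_def)
qed

lemma computable_copy_of_omega_ord: "computable_copy_of_omega ord"
proof -
  \<comment> \<open>Cross-multiplication reduces the comparison of positions to natural
    numbers.\<close>
  have "prod_decode p \<in> ord \<longleftrightarrow>
      num (pfst p) * 2 ^ psnd p < num (psnd p) * 2 ^ pfst p" for p
  proof -
    have "prod_decode p \<in> ord \<longleftrightarrow>
        real (num (pfst p) * 2 ^ psnd p) < real (num (psnd p) * 2 ^ pfst p)"
      unfolding ord_def pos_def by (simp add: case_prod_unfold field_simps)
    then show ?thesis
      unfolding of_nat_less_iff .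
  qed
  moreover have "decidable (\<lambda>p. num (pfst p) * 2 ^ psnd p < num (psnd p) * 2 ^ pfst p)"
    by (intro decidable_less computable_mult computable_power computable_comp[OF computable_num]
        computable_basic)
  ultimately have "computable_rel ord"
    by (simp add: computable_rel_def)
  moreover have "(x, y) \<in> ord \<or> (y, x) \<in> ord" if "x \<noteq> y" for x y
    using that inj_eq[OF inj_pos, of x y] by (auto simp: ord_def)
  then have "strict_linear_order ord"
    unfolding strict_linear_order_on_def total_on_def by (auto simp: ord_def trans_def irrefl_def)
  moreover have "finite {y. (y, x) \<in> ord}" for x
    using finite_pos_less by (simp add: ord_def)
  ultimately show ?thesis
    unfolding computable_copy_of_omega_def using strict_linear_order_omega by blast
qed

end

section \<open>Cohesive sets\<close>

lemma semidecidable_graph: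
  assumes "partial_computable f"
  shows "semidecidable (\<lambda>p. f (pfst p) = Some (psnd p))"
proof -
  obtain c where "f = sem c"
    using partial_computable_sem[OF assms] by blast
  then have "f (pfst p) = Some (psnd p) \<longleftrightarrow> derivable (fact (enc c) (pfst p) (psnd p))" for p
    using derivable_enc[of c "pfst p" "psnd p"] by simp
  then show ?thesis
    by (simp add: semidecidable_comp[OF semidecidable_derivable] computable_basic)
qed

lemma semidecidable_eq_Some:
  assumes "partial_computable f" "computable g" "computable h"
  shows "semidecidable (\<lambda>x. f (g x) = Some (h x))"
  using semidecidable_comp[OF semidecidable_graph[OF assms(1)] computable_pair[OF assms(2,3)]]
  by simp

text \<open>The infinitely many elements exclude the second alternative of cohesiveness. Apart from
  the infinitude of \<open>C\<close>, cohesiveness is always used through this lemma.\<close>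

lemma cohesive_semidecidable:
  assumes "cohesive C" "semidecidable P" "infinite {x \<in> C. P x}"
  shows "C \<subseteq>\<^sup>* {x. P x}"
proof -
  have "C - - {x. P x} = {x \<in> C. P x}"
    by auto
  then have "\<not> C \<subseteq>\<^sup>* - {x. P x}"
    using assms(3) by (simp add: almost_subset_def)
  then show ?thesis
    using assms(1) semidecidable_ce[OF assms(2)] unfolding cohesive_def by blast
qed

lemma infinite_card_lessThan:
  fixes C :: "nat set"
  assumes "infinite C"
  shows "\<exists>N. \<forall>n\<ge>N. r \<le> card (C \<inter> {..<n})"
proof -
  obtain A where A: "finite A" "card A = r" "A \<subseteq> C"
    using infinite_arbitrarily_large[OF assms] by blast
  obtain N where "A \<subseteq> {..<N}"
    using finite_nat_bounded[OF A(1)] by blast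
  then have "A \<subseteq> C \<inter> {..<n}" if "N \<le> n" for n
    using A(3) that by auto
  then have "r \<le> card (C \<inter> {..<n})" if "N \<le> n" for n
    using A(2) that card_mono[of "C \<inter> {..<n}" A] by simp
  then show ?thesis
    by blast
qed

text \<open>As the complement of \<open>C\<close> is enumerated, the count of numbers below
  \<open>f x\<close> not yet enumerated at stage \<open>T\<close> decreases to the true
  cardinality.\<close>

lemma semidecidable_card_le:
  assumes "co_ce C" "computable f" "computable g"
  shows "semidecidable (\<lambda>x. card (C \<inter> {..<f x}) \<le> g x)"
proof -
  obtain R where R: "decidable R" "\<And>x. x \<notin> C \<longleftrightarrow> (\<exists>t. R (pair x t))"
    using ce_semidecidable assms(1) unfolding co_ce_def semidecidable_def by force
  show ?thesis
  proof (rule semidecidableI)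
    show "decidable (\<lambda>p. (\<Sum>x<f (pfst p). of_bool (\<forall>t<psnd p. \<not> R (pair x t))) \<le> g (pfst p))"
      by (intro decidable_le computable_sum decidable_all_less decidable_not decidable_comp[OF R(1)]
          computable_basic computable_comp[OF assms(2)] computable_comp[OF assms(3)])
    fix x
    let ?S = "\<lambda>T. \<Sum>x<f x. of_bool (\<forall>t<T. \<not> R (pair x t)) :: nat"
    have S: "?S T = card {y. y < f x \<and> (\<forall>t<T. \<not> R (pair y t))}" for T
      by (simp add: sum_of_bool_eq Int_def)
    have le: "card (C \<inter> {..<f x}) \<le> ?S T" for T
      unfolding S using R(2) by (intro card_mono) auto
    have "\<forall>y. \<exists>t. y \<notin> C \<longrightarrow> R (pair y t)"
      using R(2) by blast
    then obtain w where w: "\<And>y. y \<notin> C \<Longrightarrow> R (pair y (w y))"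
      by metis
    \<comment> \<open>The sum bounds the stages at which the numbers outside \<open>C\<close>
      appear; \<open>Suc\<close> makes the bound strict.\<close>
    have "?S (Suc (\<Sum>y<f x. w y)) = card (C \<inter> {..<f x})"
      unfolding S
    proof (intro arg_cong[where f = card] set_eqI iffI)
      fix y
      assume y: "y \<in> {y. y < f x \<and> (\<forall>t<Suc (\<Sum>y<f x. w y). \<not> R (pair y t))}"
      then have "w y \<le> (\<Sum>y<f x. w y)"
        by (intro member_le_sum) auto
      then show "y \<in> C \<inter> {..<f x}"
        using y w[of y] by (auto simp: less_Suc_eq_le)
    qed (use R(2) in auto)
    then have "card (C \<inter> {..<f x}) \<le> g x \<Longrightarrow> ?S (Suc (\<Sum>y<f x. w y)) \<le> g x"
      by (simp only:)
    then show "card (C \<inter> {..<f x}) \<le> g x \<longleftrightarrow> (\<exists>T. ?S T \<le> g x)"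
      using le order_trans by blast
  qed
qed

text \<open>Each value is taken only finitely often, so first occurrences of values are found
  arbitrarily late in \<open>C\<close>. They satisfy the semidecidable \<open>P\<close>, which hence
  holds almost everywhere on \<open>C\<close> and excludes repetitions.\<close>

lemma cohesive_inj_on:
  assumes C: "co_ce C" "cohesive C" and h: "partial_computable h" "C \<subseteq>\<^sup>* dom h"
    and fin: "\<And>r. finite {n \<in> C. h n = Some r}"
  shows "\<exists>N. inj_on h (C \<inter> {N..}) \<and> C \<inter> {N..} \<subseteq> dom h"
proof -
  have bound: "\<exists>u. \<forall>n\<in>C. u \<le> n \<longrightarrow> n \<in> X" if X: "C \<subseteq>\<^sup>* X" for X
  proof -
    obtain u where "C - X \<subseteq> {..<u}"
      using finite_nat_bounded[OF X[unfolded almost_subset_def]] by blast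
    then show ?thesis
      by (intro exI[of _ u]) (auto simp: subset_iff)
  qed
  obtain u where u: "\<And>n. n \<in> C \<Longrightarrow> u \<le> n \<Longrightarrow> n \<in> dom h"
    using bound[OF h(2)] by blast
  \<comment> \<open>An \<open>m < u\<close> in \<open>C\<close> may have \<open>h m\<close>
    undefined; without the exception it would refute \<open>P n\<close> for all larger
    \<open>n\<close>.\<close>
  define P where "P n \<longleftrightarrow> (\<exists>y. h n = Some y \<and>
    (\<forall>m<n. m < u \<or> m \<in> - C \<or> (\<exists>z. h m = Some z \<and> \<not> z = y)))" for n
  have "semidecidable P"
    unfolding P_def using C(1) unfolding co_ce_def
    by (intro semidecidable_intros semidecidable_eq_Some[OF h(1)]
        semidecidable_comp[OF ce_semidecidable] semidecidable_decidable[OF decidable_not[OF decidable_eq]]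
        computable_basic)
  moreover have "infinite {n \<in> C. P n}"
    unfolding infinite_nat_iff_unbounded_le
  proof
    fix M
    let ?old = "\<Union>m\<in>C \<inter> {..<M}. {n \<in> C. h n = h m \<and> h m \<noteq> None}"
    have "finite {n \<in> C. h n = h m \<and> h m \<noteq> None}" for m
      using fin by (cases "h m") auto
    then have "finite ?old"
      by (intro finite_UN_I) auto
    then have "finite (?old \<union> {..<max M u})"
      by simp
    then have "\<not> C \<subseteq> ?old \<union> {..<max M u}"
      using C(2) finite_subset unfolding cohesive_def by blast
    then obtain n where n: "n \<in> C" "n \<notin> ?old" "max M u \<le> n"
      unfolding subset_iff Un_iff lessThan_iff not_less by (meson not_le)
    \<comment> \<open>The first element of \<open>C\<close> from \<open>u\<close> on with the value
      of \<open>n\<close>. Were it below \<open>M\<close>, then \<open>n\<close> would lie in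
      \<open>?old\<close>.\<close>
    define n' where "n' = (LEAST m. m \<in> C \<and> u \<le> m \<and> h m = h n)"
    have n': "n' \<in> C \<and> u \<le> n' \<and> h n' = h n"
      unfolding n'_def by (rule LeastI[of _ n]) (use n in auto)
    have min: "h m \<noteq> h n" if "m < n'" "m \<in> C" "u \<le> m" for m
      using that not_less_Least unfolding n'_def by blast
    obtain y where y: "h n = Some y"
      using u[of n] n by auto
    have "\<exists>z. h m = Some z \<and> z \<noteq> y" if "m < n'" "m \<in> C" "\<not> m < u" for m
      using min[of m] u[of m] that y by auto
    then have "P n'"
      unfolding P_def using n' y by auto
    moreover have "M \<le> n'"
    proof (rule ccontr)
      assume "\<not> M \<le> n'"
      then have "n \<in> ?old"
        using n(1) n' y by (intro UN_I[of n']) auto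
      with n(2) show False ..
    qed
    ultimately show "\<exists>n\<ge>M. n \<in> {n \<in> C. P n}"
      using n' by blast
  qed
  ultimately obtain v where v: "\<And>n. n \<in> C \<Longrightarrow> v \<le> n \<Longrightarrow> P n"
    using bound[OF cohesive_semidecidable[OF C(2)]] by blast
  have "h m \<noteq> h n" if "m \<in> C" "n \<in> C" "u \<le> m" "v \<le> n" "m < n" for m n
    using v[of n] that unfolding P_def by fastforce
  then have "inj_on h (C \<inter> {max u v..})"
    by (intro linorder_inj_onI) auto
  then show ?thesis
    by (intro exI[of _ "max u v"] conjI subsetI u) auto
qed

text \<open>
  The first \<open>J\<close> elements of \<open>C\<close> beyond \<open>N\<close> have distinct values, so the values cannot all lie below
  \<open>J / 2\<close>; cohesiveness turns the resulting infinitely many elements into almost all.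
\<close>

lemma cohesive_card_le:
  assumes C: "co_ce C" "cohesive C" and h: "partial_computable h" "C \<subseteq>\<^sup>* dom h"
    and fin: "\<And>r. finite {n \<in> C. h n = Some r}"
  shows "C \<subseteq>\<^sup>* {n. \<exists>r. h n = Some r \<and> card (C \<inter> {..<n}) \<le> 2 * r}"
proof (rule cohesive_semidecidable[OF C(2)])
  show "semidecidable (\<lambda>n. \<exists>r. h n = Some r \<and> card (C \<inter> {..<n}) \<le> 2 * r)"
    by (intro semidecidable_intros semidecidable_eq_Some[OF h(1)] semidecidable_card_le[OF C(1)]
        computable_basic computable_mult)
  show "infinite {n \<in> C. \<exists>r. h n = Some r \<and> card (C \<inter> {..<n}) \<le> 2 * r}"
  proof
    assume "finite {n \<in> C. \<exists>r. h n = Some r \<and> card (C \<inter> {..<n}) \<le> 2 * r}"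
    then obtain v where v: "{n \<in> C. \<exists>r. h n = Some r \<and> card (C \<inter> {..<n}) \<le> 2 * r} \<subseteq> {..<v}"
      using finite_nat_bounded by blast
    obtain u where u: "inj_on h (C \<inter> {u..})" "C \<inter> {u..} \<subseteq> dom h"
      using cohesive_inj_on[OF assms] by blast
    define N where "N = max u v"
    have less: "\<exists>r. h m = Some r \<and> 2 * r < card (C \<inter> {..<m})" if m: "m \<in> C" "N \<le> m" for m
    proof -
      have "m \<in> dom h"
        using u(2) m by (auto simp: N_def)
      then obtain r where "h m = Some r"
        by blast
      then show ?thesis
        using v m by (auto simp: N_def not_less[symmetric])
    qed
    have "infinite C"
      using C(2) by (simp add: cohesive_def)
    define j where "j = card (C \<inter> {..<N})"
    \<comment> \<open>From \<open>J = 2 * j + 2\<close> on, \<open>J\<close> exceeds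
      \<open>j + (J + 1) div 2\<close>, the bound derived below.\<close>
    obtain M where M: "\<And>n. n \<ge> M \<Longrightarrow> 2 * j + 2 \<le> card (C \<inter> {..<n})"
      using infinite_card_lessThan[OF \<open>infinite C\<close>] by blast
    define n where "n = max M N"
    define J where "J = card (C \<inter> {..<n})"
    have "C \<inter> {..<n} = (C \<inter> {..<N}) \<union> (C \<inter> {N..<n})"
      by (auto simp: n_def)
    then have "J \<le> j + card (C \<inter> {N..<n})"
      unfolding J_def j_def by (metis card_Un_le)
    moreover have "card (C \<inter> {N..<n}) \<le> (J + 1) div 2"
    proof -
      have "h ` (C \<inter> {N..<n}) \<subseteq> Some ` {..<(J + 1) div 2}"
      proof
        fix y
        assume "y \<in> h ` (C \<inter> {N..<n})"
        then obtain m where m: "m \<in> C" "N \<le> m" "m < n" "y = h m"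
          by auto
        then obtain r where r: "h m = Some r" "2 * r < card (C \<inter> {..<m})"
          using less by blast
        have "card (C \<inter> {..<m}) \<le> J"
          unfolding J_def using m by (intro card_mono) auto
        then have "r < (J + 1) div 2"
          using r(2) by linarith
        then show "y \<in> Some ` {..<(J + 1) div 2}"
          using m(4) r(1) by simp
      qed
      moreover have "inj_on h (C \<inter> {N..<n})"
        using u(1) by (rule inj_on_subset) (auto simp: N_def)
      ultimately have "card (C \<inter> {N..<n}) \<le> card (Some ` {..<(J + 1) div 2})"
        by (intro card_inj_on_le) auto
      then show ?thesis
        by (simp add: card_image)
    qed
    moreover have "2 * j + 2 \<le> J"
      unfolding J_def by (rule M) (simp add: n_def)
    ultimately show False
      by linarith
  qed
qed

section \<open>The dense order\<close>

text \<open>Least witnesses are unique. This keeps a request from being served by infinitely many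
  numbers, which would make a block infinite.\<close>

lemma semidecidable_unique_witness:
  assumes "semidecidable P"
  obtains U where "decidable U" "\<And>x. P x \<longleftrightarrow> (\<exists>t. U (pair x t))"
    "\<And>x t t'. U (pair x t) \<Longrightarrow> U (pair x t') \<Longrightarrow> t = t'"
proof -
  obtain R where R: "decidable R" "\<And>x. P x \<longleftrightarrow> (\<exists>t. R (pair x t))"
    using assms unfolding semidecidable_def by blast
  define U where "U w \<longleftrightarrow> R w \<and> (\<forall>t<psnd w. \<not> R (pair (pfst w) t))" for w
  show ?thesis
  proof
    show "decidable U"
      unfolding U_def
      by (intro decidable_and R(1) decidable_all_less decidable_not decidable_comp[OF R(1)]
          computable_basic)
    show "P x \<longleftrightarrow> (\<exists>t. U (pair x t))" for x
      unfolding R(2) U_def using exists_least_iff[of "\<lambda>t. R (pair x t)"] by auto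
    show "t = t'" if "U (pair x t)" "U (pair x t')" for x t t'
      using that unfolding U_def by (auto intro: linorder_cases[of t t'])
  qed
qed

text \<open>
  The number \<open>s\<close> is devoted to the pair \<open>s - 1\<close> of a request and a witness for it.  A request
  \<open>pair k (pair n (pair m (pair a b)))\<close> with \<open>k = pair e (pair i c)\<close> asks for an element of the
  colour \<open>c - 1\<close> (of the colour \<open>n\<close> if \<open>c = 0\<close>) between \<open>a\<close> and \<open>b\<close>, the values at \<open>n\<close> of the partial
  functions with codes \<open>e\<close> and \<open>i\<close>; \<open>m\<close> is an upper bound of the number of elements of \<open>C\<close> below \<open>n\<close>.
\<close>

definition kind :: "nat \<Rightarrow> nat" where "kind q = pfst q"
definition arg :: "nat \<Rightarrow> nat" where "arg q = pfst (psnd q)"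
definition bound :: "nat \<Rightarrow> nat" where "bound q = pfst (psnd (psnd q))"
definition lower :: "nat \<Rightarrow> nat" where "lower q = pfst (psnd (psnd (psnd q)))"
definition upper :: "nat \<Rightarrow> nat" where "upper q = psnd (psnd (psnd (psnd q)))"
definition colour :: "nat \<Rightarrow> nat \<Rightarrow> nat" where "colour c n = (if c = 0 then n else c - 1)"

lemmas request_defs = kind_def arg_def bound_def lower_def upper_def

lemma lower_le: "lower q \<le> q" and upper_le: "upper q \<le> q"
  unfolding lower_def upper_def using pfst_le psnd_le by (meson order_trans)+

text \<open>The count of \<open>C\<close> is only approximated from above, so a request carries a
  guessed bound, which the construction can test decidably. \<open>derivable\<close> makes the
  condition semidecidable uniformly in the codes.\<close>

definition request :: "nat set \<Rightarrow> nat \<Rightarrow> bool" where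
  "request C q \<longleftrightarrow> derivable (fact (pfst (kind q)) (arg q) (lower q)) \<and>
    derivable (fact (pfst (psnd (kind q))) (arg q) (upper q)) \<and> card (C \<inter> {..<arg q}) \<le> bound q"

lemma semidecidable_request: "co_ce C \<Longrightarrow> semidecidable (request C)"
  unfolding request_def request_defs
  by (intro semidecidable_and semidecidable_comp[OF semidecidable_derivable]
      semidecidable_card_le computable_basic)

definition req :: "nat \<Rightarrow> nat" where "req s = pfst (s - 1)"

text \<open>Each number receives the colour its request asks for, whether or not it is inserted, so
  the colouring is computed without consulting the order.\<close>

definition colouring :: "nat \<Rightarrow> nat" where
  "colouring s = colour (psnd (psnd (kind (req s)))) (arg (req s))"

lemma computable_req: "computable f \<Longrightarrow> computable (\<lambda>x. req (f x))"
  unfolding req_def by (intro computable_basic computable_diff)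

lemma computable_colouring: "computable colouring"
  unfolding colouring_def colour_def request_defs
  by (intro computable_if decidable_eq computable_diff computable_basic computable_req)

locale requests =
  fixes C :: "nat set" and U :: "nat \<Rightarrow> bool"
  assumes co_ce: "co_ce C" and cohesive: "cohesive C"
    and decidable_U: "decidable U"
    and request_iff: "request C q \<longleftrightarrow> (\<exists>t. U (pair q t))"
    and U_unique: "U (pair q t) \<Longrightarrow> U (pair q t') \<Longrightarrow> t = t'"
begin

text \<open>The condition \<open>0 < s\<close> matters because truncated subtraction assigns the
  same request to 0 and 1.\<close>

definition permitted :: "nat \<Rightarrow> nat \<Rightarrow> bool" where
  "permitted s l \<longleftrightarrow> 0 < s \<and> U (s - 1) \<and> kind (req s) < l \<and> bound (req s) \<le> 2 * l"

lemma infinite_C: "infinite C"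
  using cohesive by (simp add: cohesive_def)

lemma permitted_request: "permitted s l \<Longrightarrow> request C (req s)"
  unfolding request_iff permitted_def req_def by (metis prod.collapse prod_decode_inverse)

text \<open>The endpoints are values of partial functions given by the kind and argument, so the
  whole request is determined, and with it the unique witness.\<close>

lemma permitted_unique:
  assumes "permitted s l" "permitted s' l'"
    and "kind (req s) = kind (req s')" "arg (req s) = arg (req s')" "bound (req s) = bound (req s')"
  shows "s = s'"
proof -
  have "lower (req s) = lower (req s')" "upper (req s) = upper (req s')"
    using assms permitted_request derivable_unique unfolding request_def by metis+
  moreover have "q = pair (kind q) (pair (arg q) (pair (bound q) (pair (lower q) (upper q))))" for q
    by (simp add: request_defs)
  ultimately have "req s = req s'"
    using assms by metis
  moreover have "U (pair (req r) (psnd (r - 1)))" "r = Suc (pair (req r) (psnd (r - 1)))"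
    if "permitted r l" for r l
    using that by (simp_all add: permitted_def req_def)
  ultimately show ?thesis
    using assms(1,2) U_unique by metis
qed

sublocale insertion_order "\<lambda>s. lower (req s)" permitted
proof
  show "computable (\<lambda>s. lower (req s))"
    unfolding lower_def by (intro computable_basic computable_req)
  show "decidable (\<lambda>p. permitted (pfst p) (psnd p))"
    unfolding permitted_def request_defs
    by (intro decidable_and decidable_less decidable_le decidable_comp[OF decidable_U]
        computable_diff computable_mult computable_basic computable_req)
  fix r
  obtain N where N: "\<And>n. n \<ge> N \<Longrightarrow> Suc (2 * r) \<le> card (C \<inter> {..<n})"
    using infinite_card_lessThan[OF infinite_C] by blast
  \<comment> \<open>From \<open>N\<close> on, every correct upper bound of the count exceeds
    \<open>2 * r\<close>, which \<open>permitted\<close> forbids.\<close>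
  have "arg (req s) < N" if "permitted s r" for s
    using N[of "arg (req s)"] that permitted_request[OF that]
    by (force simp: permitted_def request_def)
  then have img: "(\<lambda>s. (kind (req s), arg (req s), bound (req s))) ` {s. permitted s r}
      \<subseteq> {..<r} \<times> {..<N} \<times> {..2 * r}"
    by (auto simp: permitted_def)
  have "inj_on (\<lambda>s. (kind (req s), arg (req s), bound (req s))) {s. permitted s r}"
    by (rule inj_onI, rule permitted_unique[of _ r _ r]) auto
  from this img show "finite {s. permitted s r}"
    by (rule inj_on_finite) simp
qed

text \<open>By \<open>fin\<close> the levels of \<open>f n\<close> tend to infinity along
  \<open>C\<close>, so both limits in \<open>permitted\<close> are eventually met: \<open>k\<close>
  is fixed, and \<open>cohesive_card_le\<close> compares the count of \<open>C\<close> with the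
  level.\<close>

lemma dense:
  assumes f: "f \<in> coh_reps C" and g: "g \<in> coh_reps C"
    and fin: "\<And>x. finite {n \<in> C. f n = Some x}"
    and less: "C \<subseteq>\<^sup>* {n. \<exists>x y. f n = Some x \<and> g n = Some y \<and> (x, y) \<in> ord}"
  shows "\<exists>\<theta>\<in>coh_reps C. C \<subseteq>\<^sup>* {n. \<exists>x y z. f n = Some x \<and> g n = Some y \<and> \<theta> n = Some z \<and>
    (x, z) \<in> ord \<and> (z, y) \<in> ord \<and> colouring z = colour c n}"
proof -
  obtain d d' where d: "f = sem d" and d': "g = sem d'"
    using f g partial_computable_sem unfolding coh_reps_def by blast
  define k where "k = pair (enc d) (pair (enc d') c)"
  let ?h = "map_option level \<circ> f"
  have h: "partial_computable ?h" "C \<subseteq>\<^sup>* dom ?h"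
    using coh_reps_map[OF computable_level f] unfolding coh_reps_def by blast+
  have fin_le: "finite {n \<in> C. \<exists>x. f n = Some x \<and> level x \<le> r}" for r
  proof -
    have "finite (\<Union>x\<in>{x. level x \<le> r}. {n \<in> C. f n = Some x})"
      using finite_level_le fin by blast
    then show ?thesis
      by (rule rev_finite_subset) auto
  qed
  have fin_h: "finite {n \<in> C. ?h n = Some r}" for r
    by (rule finite_subset[OF _ fin_le[of r]]) auto
  have card_le: "C \<subseteq>\<^sup>* {n. \<exists>r. ?h n = Some r \<and> card (C \<inter> {..<n}) \<le> 2 * r}"
    using cohesive_card_le[OF co_ce cohesive h fin_h] .
  have "C \<subseteq>\<^sup>* {n. \<forall>x. f n = Some x \<longrightarrow> k < level x}"
    unfolding almost_subset_def by (rule finite_subset[OF _ fin_le[of k]]) auto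
  from almost_subset_Int[OF this almost_subset_Int[OF card_le less order_refl] order_refl]
  have good: "C \<subseteq>\<^sup>* {n. \<exists>a b. f n = Some a \<and> g n = Some b \<and> (a, b) \<in> ord \<and>
      card (C \<inter> {..<n}) \<le> 2 * level a \<and> k < level a}"
    by (rule almost_subset_mono) auto
  \<comment> \<open>The bound is left open, so several elements may serve \<open>n\<close>;
    \<open>\<theta>\<close> takes the one with the least number.\<close>
  define P where "P n s \<longleftrightarrow> inserted s \<and> kind (req s) = k \<and> arg (req s) = n" for n s
  define \<theta> where "\<theta> n = (if \<exists>s. P n s then Some (LEAST s. P n s) else None)" for n
  have "decidable (\<lambda>p. P (pfst p) (psnd p))"
    unfolding P_def kind_def arg_def
    by (intro decidable_and decidable_eq decidable_comp[OF decidable_inserted] computable_basic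
        computable_req)
  from partial_computable_LEAST[OF this] have \<theta>: "partial_computable \<theta>"
    by (simp add: \<theta>_def [abs_def])
  have between: "\<exists>z. \<theta> n = Some z \<and> (a, z) \<in> ord \<and> (z, b) \<in> ord \<and> colouring z = colour c n"
    if n: "f n = Some a" "g n = Some b" "(a, b) \<in> ord" "card (C \<inter> {..<n}) \<le> 2 * level a" "k < level a"
    for n a b
  proof -
    define q where "q = pair k (pair n (pair (card (C \<inter> {..<n})) (pair a b)))"
    have "request C q"
      using n by (simp add: request_def q_def request_defs k_def derivable_enc d d')
    then obtain t where t: "U (pair q t)"
      using request_iff by blast
    define s where "s = Suc (pair q t)"
    have req: "req s = q"
      by (simp add: req_def s_def)
    have "lower q < s"
      using lower_le[of q] le_prod_encode_1[of q t] by (simp add: s_def)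
    moreover have "permitted s (level (lower q))"
      using n t by (simp add: permitted_def req) (simp add: s_def q_def request_defs)
    ultimately have "P n s"
      by (simp add: P_def inserted_def req) (simp add: q_def request_defs)
    then have "\<exists>s. P n s" ..
    then obtain z where z: "\<theta> n = Some z" "P n z"
      using LeastI_ex[of "P n"] by (simp add: \<theta>_def)
    have ins: "inserted z" "kind (req z) = k" "arg (req z) = n"
      using z(2) by (simp_all add: P_def)
    \<comment> \<open>The request of \<open>z\<close> may differ from \<open>q\<close> in its bound,
      but its endpoints are again \<open>a\<close> and \<open>b\<close>.\<close>
    have "request C (req z)"
      using ins(1) permitted_request unfolding inserted_def by blast
    then have ab: "lower (req z) = a" "upper (req z) = b"
      using n(1,2) by (simp_all add: request_def ins k_def derivable_enc d d')
    have "0 < z"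
      using ins(1) by (simp add: inserted_def)
    moreover have "b \<le> req z"
      using upper_le[of "req z"] by (simp add: ab)
    moreover have "req z \<le> z - 1"
      unfolding req_def by (rule pfst_le)
    ultimately have "b < z"
      by linarith
    then have "(a, z) \<in> ord" "(z, b) \<in> ord"
      using inserted_between[OF ins(1), of b] n(3) by (simp_all add: ord_def ab)
    moreover have "colouring z = colour c n"
      by (simp add: colouring_def ins k_def)
    ultimately show ?thesis
      using z(1) by blast
  qed
  have all: "C \<subseteq>\<^sup>* {n. \<exists>x y z. f n = Some x \<and> g n = Some y \<and> \<theta> n = Some z \<and>
      (x, z) \<in> ord \<and> (z, y) \<in> ord \<and> colouring z = colour c n}"
    using good by (rule almost_subset_mono) (use between in blast)
  then have "C \<subseteq>\<^sup>* dom \<theta>"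
    by (rule almost_subset_mono) auto
  then have "\<theta> \<in> coh_reps C"
    using \<theta> by (simp add: coh_reps_def)
  with all show ?thesis ..
qed

end

section \<open>Representatives of elements of the power\<close>

lemma coh_power_class:
  assumes "\<Phi> \<in> coh_power C" "\<phi> \<in> \<Phi>"
  shows "\<phi> \<in> coh_reps C" "\<Phi> = coh_class C \<phi>"
proof -
  obtain \<phi>' where \<phi>': "\<Phi> = coh_eq C `` {\<phi>'}"
    using assms(1) unfolding coh_power_def by (rule quotientE)
  then have eq: "(\<phi>', \<phi>) \<in> coh_eq C"
    using assms(2) by simp
  then show "\<phi> \<in> coh_reps C"
    by (simp add: coh_eq_def)
  show "\<Phi> = coh_class C \<phi>"
    unfolding \<phi>' coh_class_def by (rule equiv_class_eq[OF equiv_coh_eq eq])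
qed

lemma coh_power_cases:
  assumes "\<Phi> \<in> coh_power C"
  obtains \<phi> where "\<phi> \<in> coh_reps C" "\<Phi> = coh_class C \<phi>"
  using assms unfolding coh_power_def coh_class_def by (rule quotientE)

text \<open>By cohesiveness an infinite fibre would contain almost all of \<open>C\<close> and make
  the element standard.\<close>

lemma nonstandard_finite:
  assumes "cohesive C" "\<phi> \<in> coh_reps C" "\<not> standard C (coh_class C \<phi>)"
  shows "finite {n \<in> C. \<phi> n = Some x}"
proof (rule ccontr)
  have pc: "partial_computable \<phi>"
    using assms(2) by (simp add: coh_reps_def)
  assume "\<not> ?thesis"
  then have "C \<subseteq>\<^sup>* {n. \<phi> n = Some x}"
    by (intro cohesive_semidecidable[OF assms(1)] semidecidable_eq_Some[OF pc] computable_basic)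
  then have "C \<subseteq>\<^sup>* {n. \<exists>y. \<phi> n = Some y \<and> Some x = Some y}"
    by (rule almost_subset_mono) auto
  moreover have "(\<lambda>_. Some x) \<in> coh_reps C"
    using computable_const[of x] by (simp add: coh_reps_def computable_def almost_subset_def dom_def)
  ultimately have "coh_class C \<phi> = coh_class C (\<lambda>_. Some x)"
    using assms(2) by (simp add: coh_class_eq_iff)
  then show False
    using assms(3) unfolding standard_def by blast
qed

theorem theorem5p1:
  fixes C :: "nat set"
  assumes "co_ce C" and "cohesive C"
  shows "\<exists>(L :: nat rel) (F :: nat \<Rightarrow> nat).
    computable_copy_of_omega L \<and> computable F \<and>
    (\<forall>\<Phi> \<in> nonstandard_elements C. \<forall>\<Psi> \<in> nonstandard_elements C. (\<Psi>, \<Phi>) \<in> coh_less C L \<longrightarrow>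
      (\<forall>\<Delta> \<in> solid_colors C. \<exists>\<Theta> \<in> coh_power C.
        (\<Psi>, \<Theta>) \<in> coh_less C L \<and> (\<Theta>, \<Phi>) \<in> coh_less C L \<and> induced_coloring C F \<Theta> = \<Delta>) \<and>
      (\<exists>\<Theta> \<in> coh_power C.
        (\<Psi>, \<Theta>) \<in> coh_less C L \<and> (\<Theta>, \<Phi>) \<in> coh_less C L \<and>
        induced_coloring C F \<Theta> \<in> striped_colors C))"
proof -
  obtain U where "decidable U" "\<And>q. request C q \<longleftrightarrow> (\<exists>t. U (pair q t))"
    "\<And>q t t'. U (pair q t) \<Longrightarrow> U (pair q t') \<Longrightarrow> t = t'"
    using semidecidable_unique_witness[OF semidecidable_request[OF assms(1)]] by blast
  then interpret requests C U
    using assms by unfold_locales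
  \<comment> \<open>Both claims come from this: \<open>c = Suc x\<close> requests the solid colour
    \<open>x\<close>, and \<open>c = 0\<close> requests the colour \<open>n\<close> at
    \<open>n\<close>, which is striped.\<close>
  have between: "\<exists>\<theta>\<in>coh_reps C. coh_class C \<theta> \<in> coh_power C \<and>
      (\<Psi>, coh_class C \<theta>) \<in> coh_less C ord \<and> (coh_class C \<theta>, \<Phi>) \<in> coh_less C ord \<and>
      C \<subseteq>\<^sup>* {n. (map_option colouring \<circ> \<theta>) n = Some (colour c n)}"
    if \<Phi>: "\<Phi> \<in> nonstandard_elements C" and \<Psi>: "\<Psi> \<in> nonstandard_elements C"
      and less: "(\<Psi>, \<Phi>) \<in> coh_less C ord" for \<Phi> \<Psi> c
  proof -
    obtain \<phi> where \<phi>: "\<phi> \<in> coh_reps C" "\<Phi> = coh_class C \<phi>"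
      using \<Phi> unfolding nonstandard_elements_def by (auto elim: coh_power_cases)
    obtain \<psi> where \<psi>: "\<psi> \<in> coh_reps C" "\<Psi> = coh_class C \<psi>"
      using \<Psi> unfolding nonstandard_elements_def by (auto elim: coh_power_cases)
    then have "\<not> standard C (coh_class C \<psi>)"
      using \<Psi> by (simp add: nonstandard_elements_def)
    note fin = nonstandard_finite[OF cohesive \<psi>(1) this]
    have "C \<subseteq>\<^sup>* {n. \<exists>x y. \<psi> n = Some x \<and> \<phi> n = Some y \<and> (x, y) \<in> ord}"
      using less coh_less_class_iff[OF \<psi>(1) \<phi>(1)] by (simp add: \<phi>(2) \<psi>(2))
    from dense[OF \<psi>(1) \<phi>(1) fin this, of c]
    obtain \<theta> where \<theta>: "\<theta> \<in> coh_reps C"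
      and all: "C \<subseteq>\<^sup>* {n. \<exists>x y z. \<psi> n = Some x \<and> \<phi> n = Some y \<and> \<theta> n = Some z \<and>
        (x, z) \<in> ord \<and> (z, y) \<in> ord \<and> colouring z = colour c n}"
      by blast
    have "(\<Psi>, coh_class C \<theta>) \<in> coh_less C ord" "(coh_class C \<theta>, \<Phi>) \<in> coh_less C ord"
      unfolding \<phi>(2) \<psi>(2) coh_less_class_iff[OF \<psi>(1) \<theta>] coh_less_class_iff[OF \<theta> \<phi>(1)]
      using all by (rule almost_subset_mono, blast)+
    moreover have "C \<subseteq>\<^sup>* {n. (map_option colouring \<circ> \<theta>) n = Some (colour c n)}"
      using all by (rule almost_subset_mono) auto
    moreover have "coh_class C \<theta> \<in> coh_power C"
      unfolding coh_power_def coh_class_def using \<theta> by (rule quotientI)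
    ultimately show ?thesis
      using \<theta> by blast
  qed
  have solid: "\<exists>\<Theta>\<in>coh_power C. (\<Psi>, \<Theta>) \<in> coh_less C ord \<and> (\<Theta>, \<Phi>) \<in> coh_less C ord \<and>
      induced_coloring C colouring \<Theta> = \<Delta>"
    if hyps: "\<Phi> \<in> nonstandard_elements C" "\<Psi> \<in> nonstandard_elements C" "(\<Psi>, \<Phi>) \<in> coh_less C ord"
      and \<Delta>: "\<Delta> \<in> solid_colors C" for \<Phi> \<Psi> \<Delta>
  proof -
    obtain \<delta> x where "\<Delta> \<in> coh_power C" "\<delta> \<in> \<Delta>" and \<delta>: "C \<subseteq>\<^sup>* {n. \<delta> n = Some x}"
      using \<Delta> unfolding solid_colors_def coh_power_def by blast
    note \<delta>' = coh_power_class[OF this(1,2)]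
    obtain \<theta> where \<theta>: "\<theta> \<in> coh_reps C" "coh_class C \<theta> \<in> coh_power C"
      "(\<Psi>, coh_class C \<theta>) \<in> coh_less C ord" "(coh_class C \<theta>, \<Phi>) \<in> coh_less C ord"
      and col: "C \<subseteq>\<^sup>* {n. (map_option colouring \<circ> \<theta>) n = Some (colour (Suc x) n)}"
      using between[OF hyps] by blast
    have "C \<subseteq>\<^sup>* {n. \<exists>y. (map_option colouring \<circ> \<theta>) n = Some y \<and> \<delta> n = Some y}"
      using col \<delta> by (rule almost_subset_Int) (auto simp: colour_def)
    then have "induced_coloring C colouring (coh_class C \<theta>) = \<Delta>"
      unfolding induced_coloring_class[OF computable_colouring \<theta>(1)] \<delta>'(2)
        coh_class_eq_iff[OF coh_reps_map[OF computable_colouring \<theta>(1)] \<delta>'(1)] .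
    with \<theta> show ?thesis
      by blast
  qed
  have striped: "\<exists>\<Theta>\<in>coh_power C. (\<Psi>, \<Theta>) \<in> coh_less C ord \<and> (\<Theta>, \<Phi>) \<in> coh_less C ord \<and>
      induced_coloring C colouring \<Theta> \<in> striped_colors C"
    if hyps: "\<Phi> \<in> nonstandard_elements C" "\<Psi> \<in> nonstandard_elements C" "(\<Psi>, \<Phi>) \<in> coh_less C ord"
    for \<Phi> \<Psi>
  proof -
    obtain \<theta> where \<theta>: "\<theta> \<in> coh_reps C" "coh_class C \<theta> \<in> coh_power C"
      "(\<Psi>, coh_class C \<theta>) \<in> coh_less C ord" "(coh_class C \<theta>, \<Phi>) \<in> coh_less C ord"
      and col: "C \<subseteq>\<^sup>* {n. (map_option colouring \<circ> \<theta>) n = Some (colour 0 n)}"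
      using between[OF hyps] by blast
    let ?\<gamma> = "map_option colouring \<circ> \<theta>"
    have \<gamma>: "?\<gamma> \<in> coh_reps C"
      using coh_reps_map[OF computable_colouring \<theta>(1)] .
    \<comment> \<open>A constant representative would force \<open>n = x\<close> for almost all
      \<open>n\<close> in \<open>C\<close>, since the requested colour at \<open>n\<close> is
      \<open>n\<close> itself.\<close>
    have "\<not> C \<subseteq>\<^sup>* {n. \<delta> n = Some x}" if "\<delta> \<in> coh_class C ?\<gamma>" for \<delta> x
    proof
      assume x: "C \<subseteq>\<^sup>* {n. \<delta> n = Some x}"
      have "C \<subseteq>\<^sup>* {n. \<exists>y. ?\<gamma> n = Some y \<and> \<delta> n = Some y}"
        using that by (simp add: coh_class_def coh_eq_def)
      from almost_subset_Int[OF this almost_subset_Int[OF col x order_refl]]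
      have "C \<subseteq>\<^sup>* {x}"
        by (rule meta_mp) (auto simp: colour_def)
      then have "finite (C - {x})"
        by (simp add: almost_subset_def)
      then show False
        using infinite_C by simp
    qed
    moreover have "coh_class C ?\<gamma> \<in> coh_colors C"
      unfolding coh_class_def using \<gamma> by (rule quotientI)
    ultimately have "induced_coloring C colouring (coh_class C \<theta>) \<in> striped_colors C"
      unfolding induced_coloring_class[OF computable_colouring \<theta>(1)] striped_colors_def
        solid_colors_def by blast
    with \<theta> show ?thesis
      by blast
  qed
  show ?thesis
    using computable_copy_of_omega_ord computable_colouring solid striped
    by (intro exI[of _ ord] exI[of _ colouring]) blast
qed

end
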